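(* Let $X$ be independent of $q$. Then $$U_2\left(\frac{f_2 f_6}{f_1 f_3}\,(qX,\,q^2/X,\,q^2X,\,q/X;\,q^3)_\infty\right) = \left(\frac{f_2 f_6}{f_1 f_3}\,(qX,\,q^2/X,\,q^2X,\,q/X;\,q^3)_\infty\right)^2 .$$
   Context: All series are power series in $q$ whose coefficients do not depend on $q$; with $X$ an (invertible) parameter independent of $q$, they may be read as elements of $\mathbb{Z}[X,X^{-1}][[q]]$. The $q$-Pochhammer symbol is $(a;q)_\infty := \prod_{k\ge 0}(1-aq^k)$, so that $(a;q^m)_\infty=\prod_{k\ge 0}(1-aq^{mk})$, and $(a_1,a_2,\ldots,a_r;q^m)_\infty := \prod_{j=1}^r (a_j;q^m)_\infty$. For a positive integer $i$, $f_i := (q^i;q^i)_\infty=\prod_{k\ge 1}(1-q^{ik})$. For a positive integer $m$, the unitizing operator of degree $m$ acts on power series in $q$ by $U_m\left(\sum_{n\ge 0} a_n q^n\right) := \sum_{n\ge 0} a_{mn} q^n$, where the coefficients $a_n$ are independent of $q$. *)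

theory Defs
  imports
    "HOL-Analysis.Infinite_Products"
    "HOL-Computational_Algebra.Formal_Power_Series"
begin

text \<open>
  Series in \<open>q\<close> are formal power series over an arbitrary commutative ring, with \<open>q\<close> being
  \<^const>\<open>fps_X\<close>. A parameter independent of \<open>q\<close> is a constant series \<open>fps_const X\<close>, where \<open>X\<close> is
  a unit of the coefficient ring. The ring of Laurent polynomials over the integers is an instance:
  it is the group ring \<open>int \<Rightarrow>\<^sub>0 int\<close> of HOL-Library.Poly_Mapping, with \<open>X = Poly_Mapping.single 1 1\<close>.
\<close>

text \<open>
  The infinite product is taken in the \<open>q\<close>-adic topology, which is the library's metric topology on
  formal power series.
\<close>

definition qpoch_inf :: "'a::comm_ring_1 fps \<Rightarrow> 'a fps \<Rightarrow> 'a fps" where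
  "qpoch_inf a Q = (\<Prod>k. 1 - a * Q ^ k)"

definition qpochs_inf :: "'a::comm_ring_1 fps list \<Rightarrow> 'a fps \<Rightarrow> 'a fps" where
  "qpochs_inf as Q = (\<Prod>a\<leftarrow>as. qpoch_inf a Q)"

definition euler_f :: "nat \<Rightarrow> 'a::comm_ring_1 fps" where
  "euler_f i = qpoch_inf (fps_X ^ i) (fps_X ^ i)"

text \<open>
  Division of formal power series in the library needs a division operation on the coefficients.
  Here denominators have constant term \<open>1\<close>, so they are invertible over every commutative ring;
  the second argument of \<open>fps_right_inverse\<close> is the constant term of the inverse.
\<close>

definition fps_unit_quot :: "'a::comm_ring_1 fps \<Rightarrow> 'a fps \<Rightarrow> 'a fps" where
  "fps_unit_quot F G = F * fps_right_inverse G 1"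

definition unitize :: "nat \<Rightarrow> 'a fps \<Rightarrow> 'a fps" where
  "unitize m F = Abs_fps (\<lambda>n. fps_nth F (m * n))"

text \<open>The definitions are meaningful for the arguments that occur below.\<close>

lemma qpoch_inf_has_prod:
  fixes a Q :: "'a::comm_ring_1 fps"
  assumes a: "fps_nth a 0 = 0" and Q: "fps_nth Q 0 = 0"
  shows "(\<lambda>k. 1 - a * Q ^ k) has_prod qpoch_inf a Q"
    and "fps_nth (qpoch_inf a Q) 0 = 1"
proof -
  let ?f = "\<lambda>k. 1 - a * Q ^ k"
  let ?P = "\<lambda>n. \<Prod>k\<le>n. ?f k"
  have nth0: "fps_nth (?f k) 0 = 1" for k
    using a by simp
  have low: "fps_nth (Q ^ k) j = 0" if "j < k" for j k
    using that Q by (rule startsby_zero_power_prefix[rule_format, rotated])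
  have nth_Suc: "fps_nth (?P (Suc n)) i = fps_nth (?P n) i" if "i \<le> n" for i n
  proof -
    have "fps_nth (a * Q ^ Suc n) j = 0" if "j \<le> n" for j
      unfolding fps_mult_nth using that low
      by (intro sum.neutral) (auto simp del: power_Suc)
    hence "fps_nth (?P n * (a * Q ^ Suc n)) i = 0"
      unfolding fps_mult_nth[of "?P n"] using that
      by (intro sum.neutral) (auto simp del: power_Suc)
    moreover have "?P (Suc n) = ?P n - ?P n * (a * Q ^ Suc n)"
      by (simp add: algebra_simps del: power_Suc)
    ultimately show ?thesis
      by simp
  qed
  define L where "L = Abs_fps (\<lambda>n. fps_nth (?P n) n)"
  have stable: "fps_nth (?P n) i = fps_nth L i" if "i \<le> n" for i n
    using that
  proof (induction n rule: dec_induct)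
    case base
    then show ?case by (simp add: L_def)
  next
    case (step n)
    then show ?case using nth_Suc[of i n] by simp
  qed
  have lim: "?P \<longlonglongrightarrow> L"
    unfolding tendsto_fps_iff
  proof
    fix i
    show "\<forall>\<^sub>F n in sequentially. fps_nth (?P n) i = fps_nth L i"
      using eventually_ge_at_top[of i] by eventually_elim (rule stable)
  qed
  have L0: "fps_nth L 0 = 1"
    using a by (simp add: L_def)
  hence "L \<noteq> 0"
    by auto
  with lim have hp: "?f has_prod L"
    by (simp add: has_prod_def raw_has_prod_def)
  have "?f k \<noteq> 0" for k
    using nth0[of k] by (metis fps_zero_nth zero_neq_one)
  hence "p = L" if "?f has_prod p" for p
    using that lim by (auto simp: has_prod_def raw_has_prod_def intro: LIMSEQ_unique)
  with hp have "(THE p. ?f has_prod p) = L"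
    by (intro the_equality)
  hence "qpoch_inf a Q = L"
    by (simp add: qpoch_inf_def prodinf_def)
  with hp L0 show "?f has_prod qpoch_inf a Q" and "fps_nth (qpoch_inf a Q) 0 = 1"
    by simp_all
qed

lemma fps_unit_quot_mult:
  fixes F G :: "'a::comm_ring_1 fps"
  assumes "fps_nth G 0 = 1"
  shows "fps_unit_quot F G * G = F"
  using fps_right_inverse[of G 1] assms by (simp add: fps_unit_quot_def mult.left_commute mult.commute[of _ G])

end

theory Submission
  imports Defs
begin

text \<open>
  Write \<open>T(q)\<close> for the four-fold product, \<open>\<psi>(q) = \<Sum> q^(2n^2+n)\<close> and \<open>\<phi>(q) = \<Sum> q^(n^2)\<close>.
  Sorting the factors by the parity of the exponents gives \<open>T(q) = T(q^2) \<theta>(q)\<close> with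
  \<open>\<theta>(q) = (qX, q^5/X, q^5X, q/X; q^6)\<close>. By the Jacobi triple product, and by passing to the sum and
  difference of the two summation indices,
  \<open>f_3^2 T(q) = U(q) \<beta>(q) + q V(q) \<alpha>(q)\<close> and
  \<open>f_6^2 \<theta>(q) = U(q^2) \<alpha>(q^2) + q V(q^2) \<beta>(q^2)\<close>
  with the same \<open>U, V\<close>, where \<open>\<alpha>(q) = \<Sum> q^(3n^2+2n)\<close> and \<open>\<beta>(q) = \<Sum> q^(3n^2-n)\<close> do not involve \<open>X\<close>.
  Since \<open>\<psi>(q) \<psi>(q^3) = f_2^2 f_6^2 / (f_1 f_3)\<close>, the quotient \<open>1 / (f_1 f_3)\<close> is dissected by
  \<open>\<psi>(q) \<psi>(q^3) = \<phi>(q^6) \<psi>(q^4) + q \<phi>(q^2) \<psi>(q^12)\<close>. The product formulas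
  \<open>\<phi>(q^3) \<psi>(q^2) \<alpha>(q) = \<psi>(q) \<psi>(q^3) \<beta>(q)\<close> and \<open>\<phi>(q) \<psi>(q^6) \<beta>(q) = \<psi>(q) \<psi>(q^3) \<alpha>(q)\<close>
  then turn the even part of \<open>\<theta>(q) \<psi>(q) \<psi>(q^3)\<close> into a multiple of \<open>T\<close>.
\<close>

subsection \<open>Congruences modulo powers of \<open>q\<close>\<close>

lemma fps_X_power_dvd_iff:
  "fps_X ^ N dvd (f :: 'a::comm_ring_1 fps) \<longleftrightarrow> (\<forall>i<N. fps_nth f i = 0)"
proof
  assume "fps_X ^ N dvd f"
  then show "\<forall>i<N. fps_nth f i = 0"
    by (auto simp: dvd_def fps_X_power_mult_nth)
next
  assume *: "\<forall>i<N. fps_nth f i = 0"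
  have "f = fps_X ^ N * fps_shift N f"
    by (rule fps_ext) (use * in \<open>auto simp: fps_X_power_mult_nth\<close>)
  then show "fps_X ^ N dvd f" by (metis dvd_triv_left)
qed

text \<open>The \<open>q\<close>-adic topology is separated: infinite products are compared through
  finite truncations modulo every power of \<open>q\<close>.\<close>

lemma fps_eq_by_dvd:
  fixes f g :: "'a::comm_ring_1 fps"
  assumes "\<And>N. fps_X ^ N dvd f - g"
  shows "f = g"
proof (rule fps_ext)
  fix n
  show "fps_nth f n = fps_nth g n"
    using assms[of "Suc n"] unfolding fps_X_power_dvd_iff by auto
qed

lemma dvd_diff_mult_cong:
  fixes a b c d t :: "'a::comm_ring_1"
  assumes "t dvd a - b" "t dvd c - d"
  shows "t dvd a * c - b * d"
proof -
  have "a * c - b * d = (a - b) * c + b * (c - d)" by (simp add: algebra_simps)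
  then show ?thesis using assms by (metis dvd_add dvd_mult dvd_mult2)
qed

lemma dvd_diff_prod_cong:
  fixes f g :: "'i \<Rightarrow> 'a::comm_ring_1"
  assumes "\<And>i. i \<in> I \<Longrightarrow> t dvd f i - g i"
  shows "t dvd prod f I - prod g I"
  using assms
  by (induction I rule: infinite_finite_induct) (auto intro: dvd_diff_mult_cong)

lemma dvd_diff_trans:
  fixes a b c t :: "'a::comm_ring_1"
  assumes "t dvd a - b" "t dvd b - c"
  shows "t dvd a - c"
  using dvd_add[OF assms] by simp

lemma dvd_diff_trans2:
  fixes a b c t :: "'a::comm_ring_1"
  assumes "t dvd a - b" "t dvd c - b"
  shows "t dvd a - c"
  using dvd_diff[OF assms] by simp

text \<open>The coefficient ring may have zero divisors; cancellation rests on the constant term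
  \<open>1\<close>, which makes the factor invertible.\<close>

lemma fps_unit_cancel:
  fixes D f g :: "'a::comm_ring_1 fps"
  assumes "fps_nth D 0 = 1" "D * f = D * g"
  shows "f = g"
proof -
  have D: "D * fps_right_inverse D 1 = 1"
    using assms by (intro fps_right_inverse) simp
  have "f = (D * fps_right_inverse D 1) * f" by (simp add: D)
  also have "\<dots> = fps_right_inverse D 1 * (D * f)" by (simp add: mult_ac)
  also have "\<dots> = (D * fps_right_inverse D 1) * g" unfolding assms(2) by (simp add: mult_ac)
  finally show ?thesis by (simp add: D)
qed

subsection \<open>Infinite products in arithmetic progressions\<close>

definition qp :: "'a::comm_ring_1 \<Rightarrow> nat \<Rightarrow> nat \<Rightarrow> 'a fps" where
  "qp c a m = qpoch_inf (fps_const c * fps_X ^ a) (fps_X ^ m)"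

abbreviation qpfac :: "'a::comm_ring_1 \<Rightarrow> nat \<Rightarrow> nat \<Rightarrow> nat \<Rightarrow> 'a fps" where
  "qpfac c a m k \<equiv> 1 - fps_const c * fps_X ^ (a + m * k)"

lemma qp_nth_0: "0 < a \<Longrightarrow> 0 < m \<Longrightarrow> fps_nth (qp c a m) 0 = 1"
  unfolding qp_def by (rule qpoch_inf_has_prod) (auto simp: fps_X_power_iff)

lemma qpfac_prod_approx:
  fixes c :: "'a::comm_ring_1"
  assumes "0 < m" "N \<le> n" "n \<le> n'"
  shows "fps_X ^ N dvd (\<Prod>k<n'. qpfac c a m k) - (\<Prod>k<n. qpfac c a m k)"
  using assms(3)
proof (induction n' rule: dec_induct)
  case (step k)
  have "N \<le> m * k" using assms step by (metis le_trans mult_le_mono1 One_nat_def Suc_leI mult_1)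
  then have "fps_X ^ N dvd (fps_X ^ (a + m * k) :: 'a fps)"
    by (intro le_imp_power_dvd) simp
  moreover have "(\<Prod>k<Suc k. qpfac c a m k) - (\<Prod>k<k. qpfac c a m k) =
      - (fps_const c * (\<Prod>k<k. qpfac c a m k)) * fps_X ^ (a + m * k)"
    by (simp add: algebra_simps)
  ultimately have "fps_X ^ N dvd (\<Prod>k<Suc k. qpfac c a m k) - (\<Prod>k<k. qpfac c a m k)"
    by (metis dvd_mult)
  then show ?case using step(3) by (rule dvd_diff_trans)
qed simp

lemma qp_approx:
  fixes c :: "'a::comm_ring_1"
  assumes "0 < a" "0 < m" "N \<le> n"
  shows "fps_X ^ N dvd qp c a m - (\<Prod>k<n. qpfac c a m k)"
proof -
  have "(\<lambda>k. 1 - fps_const c * fps_X ^ a * (fps_X ^ m) ^ k) has_prod qp c a m"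
    unfolding qp_def by (rule qpoch_inf_has_prod) (use assms in \<open>auto simp: fps_X_power_iff\<close>)
  moreover have "(\<lambda>k. 1 - fps_const c * fps_X ^ a * (fps_X ^ m) ^ k) = qpfac c a m"
    by (simp add: fun_eq_iff power_add power_mult mult.assoc)
  ultimately have "qpfac c a m has_prod qp c a m" by simp
  \<comment> \<open>A nonzero value excludes the clause of \<open>has_prod\<close> for vanishing
    factors and leaves plain convergence of the partial products.\<close>
  moreover have "qp c a m \<noteq> 0" using qp_nth_0[of a m c] assms by auto
  ultimately have "(\<lambda>n. \<Prod>k\<le>n. qpfac c a m k) \<longlonglongrightarrow> qp c a m"
    by (auto simp: has_prod_def raw_has_prod_def)
  then have "\<forall>\<^sub>F n in sequentially. fps_nth (\<Prod>k\<le>n. qpfac c a m k) i = fps_nth (qp c a m) i" for i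
    by (simp add: tendsto_fps_iff)
  then have "\<forall>\<^sub>F n in sequentially. \<forall>i\<in>{..<N}.
      fps_nth (\<Prod>k\<le>n. qpfac c a m k) i = fps_nth (qp c a m) i"
    by (simp add: eventually_ball_finite)
  then obtain n1 where n1: "\<And>n i. n \<ge> n1 \<Longrightarrow> i < N \<Longrightarrow>
      fps_nth (\<Prod>k\<le>n. qpfac c a m k) i = fps_nth (qp c a m) i"
    unfolding eventually_sequentially by blast
  have "fps_X ^ N dvd qp c a m - (\<Prod>k<Suc (max n n1). qpfac c a m k)"
    unfolding fps_X_power_dvd_iff lessThan_Suc_atMost using n1[of "max n n1"] by simp
  moreover have "fps_X ^ N dvd (\<Prod>k<Suc (max n n1). qpfac c a m k) - (\<Prod>k<n. qpfac c a m k)"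
    by (rule qpfac_prod_approx) (use assms in auto)
  ultimately show ?thesis by (rule dvd_diff_trans)
qed

text \<open>The factors are sorted by their index modulo \<open>s\<close>; truncating at
  \<open>s * N\<close> factors leaves exactly \<open>N\<close> in each class.\<close>

lemma qp_split:
  assumes "0 < a" "0 < m" "0 < s"
  shows "qp c a m = (\<Prod>r<s. qp c (a + m * r) (m * s))"
proof (rule fps_eq_by_dvd)
  fix N
  have 1: "fps_X ^ N dvd qp c a m - (\<Prod>k<s * N. qpfac c a m k)"
    by (rule qp_approx) (use assms in auto)
  have "(\<Prod>k<s * N. qpfac c a m k) = (\<Prod>(k, r)\<in>{..<N} \<times> {..<s}. qpfac c a m (s * k + r))"
  proof (rule prod.reindex_bij_witness[where i = "\<lambda>(k, r). s * k + r" and j = "\<lambda>n. (n div s, n mod s)"])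
    fix p assume "p \<in> {..<N} \<times> {..<s}"
    then obtain k r where p: "p = (k, r)" "k < N" "r < s" by auto
    have "s * k + r < s * Suc k" using p by simp
    also have "\<dots> \<le> s * N" using p by (intro mult_le_mono2) simp
    finally show "(\<lambda>(k, r). s * k + r) p \<in> {..<s * N}" using p by simp
  qed (use assms in \<open>auto simp: less_mult_imp_div_less mult.commute\<close>)
  also have "\<dots> = (\<Prod>r<s. \<Prod>k<N. qpfac c a m (s * k + r))"
    by (subst prod.swap) (simp add: prod.cartesian_product)
  also have "\<dots> = (\<Prod>r<s. \<Prod>k<N. qpfac c (a + m * r) (m * s) k)"
    by (simp add: algebra_simps)
  finally have 2: "(\<Prod>k<s * N. qpfac c a m k) = (\<Prod>r<s. \<Prod>k<N. qpfac c (a + m * r) (m * s) k)" .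
  have 3: "fps_X ^ N dvd (\<Prod>r<s. qp c (a + m * r) (m * s)) -
      (\<Prod>r<s. \<Prod>k<N. qpfac c (a + m * r) (m * s) k)"
    by (intro dvd_diff_prod_cong qp_approx) (use assms in auto)
  show "fps_X ^ N dvd qp c a m - (\<Prod>r<s. qp c (a + m * r) (m * s))"
    using dvd_diff_trans2[OF 1[unfolded 2] 3] .
qed

lemma qp_mult_neg:
  assumes "0 < a" "0 < m"
  shows "qp c a m * qp (- c) a m = qp (c\<^sup>2) (2 * a) (2 * m)"
proof (rule fps_eq_by_dvd)
  fix N
  have 1: "fps_X ^ N dvd qp c a m * qp (- c) a m - (\<Prod>k<N. qpfac c a m k) * (\<Prod>k<N. qpfac (- c) a m k)"
    by (intro dvd_diff_mult_cong qp_approx) (use assms in auto)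
  have "qpfac c a m k * qpfac (- c) a m k = qpfac (c\<^sup>2) (2 * a) (2 * m) k" for k
  proof -
    have "fps_X ^ (2 * a + 2 * m * k) = (fps_X ^ (a + m * k) * fps_X ^ (a + m * k) :: 'a fps)"
      by (simp only: power_add[symmetric]) (simp add: algebra_simps mult_2)
    moreover have "fps_const (c\<^sup>2) = fps_const c * fps_const c" "fps_const (- c) = - fps_const c"
      by (simp_all add: power2_eq_square)
    moreover have "(1 - C * E) * (1 - - C * E) = 1 - C * C * (E * E)" for C E :: "'a fps"
      by (simp add: algebra_simps)
    ultimately show ?thesis by (simp only:)
  qed
  then have 2: "(\<Prod>k<N. qpfac c a m k) * (\<Prod>k<N. qpfac (- c) a m k) = (\<Prod>k<N. qpfac (c\<^sup>2) (2 * a) (2 * m) k)"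
    by (simp add: prod.distrib[symmetric])
  have 3: "fps_X ^ N dvd qp (c\<^sup>2) (2 * a) (2 * m) - (\<Prod>k<N. qpfac (c\<^sup>2) (2 * a) (2 * m) k)"
    by (intro qp_approx) (use assms in auto)
  show "fps_X ^ N dvd qp c a m * qp (- c) a m - qp (c\<^sup>2) (2 * a) (2 * m)"
    using dvd_diff_trans2[OF 1[unfolded 2] 3] .
qed

subsection \<open>The substitution of \<open>q^2\<close> for \<open>q\<close>\<close>

definition dil :: "'a::comm_ring_1 fps \<Rightarrow> 'a fps" where
  "dil f = Abs_fps (\<lambda>n. if even n then fps_nth f (n div 2) else 0)"

lemma dil_mult_nth: "fps_nth (dil f * g) n = (\<Sum>i\<le>n div 2. fps_nth f i * fps_nth g (n - 2 * i))"
proof -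
  have "fps_nth (dil f * g) n = (\<Sum>i\<in>{0..n}. fps_nth (dil f) i * fps_nth g (n - i))"
    by (simp add: fps_mult_nth)
  also have "\<dots> = (\<Sum>i\<in>(\<lambda>i. 2 * i) ` {..n div 2}. fps_nth (dil f) i * fps_nth g (n - i))"
  proof (rule sum.mono_neutral_right)
    show "\<forall>i\<in>{0..n} - (\<lambda>i. 2 * i) ` {..n div 2}. fps_nth (dil f) i * fps_nth g (n - i) = 0"
    proof
      fix i assume i: "i \<in> {0..n} - (\<lambda>i. 2 * i) ` {..n div 2}"
      have "odd i"
      proof
        assume "even i"
        then obtain j where "i = 2 * j" by (elim evenE)
        with i show False by auto
      qed
      then show "fps_nth (dil f) i * fps_nth g (n - i) = 0" by (simp add: dil_def)
    qed
  qed auto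
  also have "\<dots> = (\<Sum>i\<le>n div 2. fps_nth f i * fps_nth g (n - 2 * i))"
    by (subst sum.reindex) (auto simp: dil_def inj_on_def)
  finally show ?thesis .
qed

text \<open>In an even degree, an even index of the first factor meets an even index of the second.
  So a factor that is a series in \<open>q^2\<close> can be pulled out of the operator.\<close>

lemma unitize_dil_mult: "unitize 2 (dil f * g) = f * unitize 2 g"
  by (rule fps_ext)
    (auto simp: unitize_def dil_mult_nth fps_mult_nth[of f] atLeast0AtMost right_diff_distrib')

lemma unitize_X_dil: "unitize 2 (fps_X * dil f) = 0"
  by (rule fps_ext) (auto simp: unitize_def dil_def)

lemma unitize_dil: "unitize 2 (dil f) = f"
  by (rule fps_ext) (auto simp: unitize_def dil_def)

lemma unitize_add: "unitize m (f + g) = unitize m f + unitize m (g::'a::comm_ring_1 fps)"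
  by (rule fps_ext) (auto simp: unitize_def)

lemma dil_mult: "dil (f * g) = dil f * dil g"
proof (rule fps_ext)
  fix n
  show "fps_nth (dil (f * g)) n = fps_nth (dil f * dil g) n"
  proof (cases "even n")
    case True
    then obtain k where "n = 2 * k" by (elim evenE)
    then have "fps_nth (dil f * dil g) n = (\<Sum>i\<le>k. fps_nth f i * fps_nth (dil g) (2 * (k - i)))"
      unfolding dil_mult_nth by (simp add: right_diff_distrib')
    also have "\<dots> = (\<Sum>i\<le>k. fps_nth f i * fps_nth g (k - i))"
      by (simp add: dil_def)
    finally show ?thesis
      using \<open>n = 2 * k\<close> by (simp add: fps_mult_nth atLeast0AtMost dil_def[of "f * g"])
  next
    case False
    then have "odd (n - 2 * i)" if "i \<le> n div 2" for i
      using that by presburger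
    then have "fps_nth (dil f * dil g) n = 0"
      unfolding dil_mult_nth by (intro sum.neutral) (auto simp: dil_def)
    then show ?thesis using False by (simp add: dil_def[of "f * g"])
  qed
qed

lemma dil_1: "dil 1 = 1"
  by (rule fps_ext) (auto simp: dil_def)

lemma dil_diff: "dil (f - g) = dil f - dil g"
  by (rule fps_ext) (auto simp: dil_def)

lemma dil_add: "dil (f + g) = dil f + dil g"
  by (rule fps_ext) (auto simp: dil_def)

lemma dil_prod: "dil (prod f I) = (\<Prod>i\<in>I. dil (f i))"
  by (induction I rule: infinite_finite_induct) (auto simp: dil_1 dil_mult)

lemma dil_fps_const: "dil (fps_const c) = fps_const c"
  by (rule fps_ext) (auto simp: dil_def)

lemma dil_X_power: "dil (fps_X ^ n) = fps_X ^ (2 * n)"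
  by (rule fps_ext) (auto simp: dil_def)

lemma dil_qpfac: "dil (qpfac c a m k) = qpfac c (2 * a) (2 * m) k"
  by (simp add: dil_diff dil_1 dil_mult dil_fps_const dil_X_power algebra_simps)

text \<open>A truncation error divisible by \<open>q^N\<close> becomes one divisible by
  \<open>q^(2 * N)\<close>.\<close>

lemma dil_qp:
  assumes "0 < a" "0 < m"
  shows "dil (qp c a m) = qp c (2 * a) (2 * m)"
proof (rule fps_eq_by_dvd)
  fix N
  have "fps_X ^ N dvd qp c a m - (\<Prod>k<N. qpfac c a m k)"
    by (rule qp_approx) (use assms in auto)
  then obtain h where "qp c a m - (\<Prod>k<N. qpfac c a m k) = fps_X ^ N * h" by (elim dvdE)
  then have "dil (qp c a m) - (\<Prod>k<N. qpfac c (2 * a) (2 * m) k) = fps_X ^ (2 * N) * dil h"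
    by (metis (no_types, lifting) dil_diff dil_mult dil_X_power dil_prod dil_qpfac prod.cong)
  then have 1: "fps_X ^ N dvd dil (qp c a m) - (\<Prod>k<N. qpfac c (2 * a) (2 * m) k)"
    by (metis dvd_triv_left dvd_trans le_add1 le_imp_power_dvd mult_2)
  have 3: "fps_X ^ N dvd qp c (2 * a) (2 * m) - (\<Prod>k<N. qpfac c (2 * a) (2 * m) k)"
    by (intro qp_approx) (use assms in auto)
  show "fps_X ^ N dvd dil (qp c a m) - qp c (2 * a) (2 * m)"
    using dvd_diff_trans2[OF 1 3] .
qed

subsection \<open>The Jacobi triple product\<close>

definition qfac :: "'a::comm_ring_1 fps \<Rightarrow> nat \<Rightarrow> 'a fps" where
  "qfac Q k = (\<Prod>i<k. 1 - Q ^ Suc i)"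

definition qfac_inv :: "'a::comm_ring_1 fps \<Rightarrow> nat \<Rightarrow> 'a fps" where
  "qfac_inv Q k = fps_right_inverse (qfac Q k) 1"

text \<open>The Gaussian binomial coefficient, with inverses of series of constant term
  \<open>1\<close> in place of a quotient. The value \<open>0\<close> beyond \<open>M\<close> lets
  sums be extended by one term.\<close>

definition gbin :: "'a::comm_ring_1 fps \<Rightarrow> nat \<Rightarrow> nat \<Rightarrow> 'a fps" where
  "gbin Q M j = (if j \<le> M then qfac Q M * (qfac_inv Q j * qfac_inv Q (M - j)) else 0)"

context
  fixes Q :: "'a::comm_ring_1 fps"
  assumes Q0: "fps_nth Q 0 = 0"
begin

lemma qfac_nth_0: "fps_nth (qfac Q k) 0 = 1"
  by (induction k) (use Q0 in \<open>auto simp: qfac_def\<close>)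

lemma qfac_mult_inv: "qfac Q k * qfac_inv Q k = 1"
  unfolding qfac_inv_def by (intro fps_right_inverse) (simp add: qfac_nth_0)

lemma qfac_Suc: "qfac Q (Suc k) = qfac Q k * (1 - Q ^ Suc k)"
  by (simp add: qfac_def)

lemma qfac_inv_eq: "qfac_inv Q k = (1 - Q ^ Suc k) * qfac_inv Q (Suc k)"
proof (rule fps_unit_cancel[OF qfac_nth_0[of k]])
  show "qfac Q k * qfac_inv Q k = qfac Q k * ((1 - Q ^ Suc k) * qfac_inv Q (Suc k))"
    using qfac_mult_inv[of "Suc k"] unfolding qfac_Suc mult.assoc by (simp only: qfac_mult_inv)
qed

lemma qfac_inv_0: "qfac_inv Q 0 = 1"
  using qfac_mult_inv[of 0] by (simp add: qfac_def)

lemma gbin_0: "gbin Q M 0 = 1"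
  by (simp add: gbin_def qfac_inv_0 qfac_mult_inv)

lemma gbin_self: "gbin Q M M = 1"
  by (simp add: gbin_def qfac_inv_0 qfac_mult_inv)

text \<open>Over the common denominator, with \<open>x = Q ^ Suc j\<close> and
  \<open>y = Q ^ (M - j)\<close>, this is \<open>1 - x * y = (1 - x) + x * (1 - y)\<close>.\<close>

lemma gbin_Suc_Suc: "gbin Q (Suc M) (Suc j) = gbin Q M j + Q ^ Suc j * gbin Q M (Suc j)"
proof -
  consider "j < M" | "j = M" | "j > M" by linarith
  then show ?thesis
  proof cases
    case 1
    then obtain l where M: "M = Suc (j + l)" by (metis add_Suc_right less_imp_Suc_add)
    define x y where "x = Q ^ Suc j" and "y = Q ^ Suc l"
    have "Q ^ Suc M = x * y" by (simp add: x_def y_def M power_add mult_ac)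
    then have "gbin Q (Suc M) (Suc j) = qfac Q M * (1 - x * y) * (qfac_inv Q (Suc j) * qfac_inv Q (Suc l))"
      using 1 by (simp add: gbin_def qfac_Suc M)
    moreover have "gbin Q M j = qfac Q M * ((1 - x) * qfac_inv Q (Suc j) * qfac_inv Q (Suc l))"
      using 1 by (simp add: gbin_def M x_def qfac_inv_eq[of j])
    moreover have "gbin Q M (Suc j) = qfac Q M * (qfac_inv Q (Suc j) * ((1 - y) * qfac_inv Q (Suc l)))"
      using 1 by (simp add: gbin_def M y_def qfac_inv_eq[of l])
    ultimately show ?thesis unfolding x_def[symmetric] by (simp only:) (simp add: algebra_simps)
  next
    case 2
    then show ?thesis using gbin_self[of M] gbin_self[of "Suc M"] by (simp add: gbin_def)
  qed (simp add: gbin_def)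
qed

text \<open>The mirrored Pascal rule, from \<open>1 - x * y = y * (1 - x) + (1 - y)\<close>.\<close>

lemma gbin_Suc_Suc':
  assumes "j \<le> M"
  shows "gbin Q (Suc M) (Suc j) = Q ^ (M - j) * gbin Q M j + gbin Q M (Suc j)"
proof (cases "j = M")
  case True
  then show ?thesis using gbin_self[of M] gbin_self[of "Suc M"] by (simp add: gbin_def)
next
  case False
  then obtain l where M: "M = Suc (j + l)" using assms
    by (metis add_Suc_right le_neq_implies_less less_imp_Suc_add)
  define x y where "x = Q ^ Suc j" and "y = Q ^ Suc l"
  have "Q ^ Suc M = x * y" by (simp add: x_def y_def M power_add mult_ac)
  then have "gbin Q (Suc M) (Suc j) = qfac Q M * (1 - x * y) * (qfac_inv Q (Suc j) * qfac_inv Q (Suc l))"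
    by (simp add: gbin_def qfac_Suc M)
  moreover have "gbin Q M j = qfac Q M * ((1 - x) * qfac_inv Q (Suc j) * qfac_inv Q (Suc l))"
    by (simp add: gbin_def M x_def qfac_inv_eq[of j])
  moreover have "gbin Q M (Suc j) = qfac Q M * (qfac_inv Q (Suc j) * ((1 - y) * qfac_inv Q (Suc l)))"
    by (simp add: gbin_def M y_def qfac_inv_eq[of l])
  moreover have "Q ^ (M - j) = y" by (simp add: M y_def)
  ultimately show ?thesis by (simp only:) (simp add: algebra_simps)
qed

text \<open>
  The weights stand for \<open>w n = A^n Q^(n(n-1)/2)\<close> with \<open>A * B = Q\<close>. The two assumptions, which
  have only natural exponents, make sense of this for negative \<open>n\<close> although \<open>A\<close> is not invertible.
\<close>

lemma finite_triple_product:
  fixes w :: "int \<Rightarrow> 'a fps"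
  assumes A: "\<And>N n. n \<le> int N \<Longrightarrow> A * Q ^ N * w n = w (n + 1) * Q ^ nat (int N - n)"
    and B: "\<And>L n. - n \<le> int L \<Longrightarrow> B * Q ^ L * w n = w (n - 1) * Q ^ nat (int L + n)"
    and w0: "w 0 = 1"
  shows "(\<Prod>k<N. 1 + A * Q ^ k) * (\<Prod>k<L. 1 + B * Q ^ k) =
    (\<Sum>j\<le>N + L. gbin Q (N + L) j * w (int j - int L))"
proof (induction L)
  \<comment> \<open>Without \<open>B\<close> factors this is the \<open>Q\<close>-binomial theorem.
    Each new \<open>A\<close> factor raises the index of the weights by one, and
    \<open>gbin_Suc_Suc'\<close> merges the coefficients.\<close>
  case 0
  show ?case
  proof (induction N)
    case 0
    then show ?case by (simp add: gbin_0 w0)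
  next
    case (Suc N)
    have "(\<Prod>k<Suc N. 1 + A * Q ^ k) = (\<Sum>j\<le>N. gbin Q N j * w (int j)) * (1 + A * Q ^ N)"
      using Suc by simp
    also have "\<dots> = (\<Sum>j\<le>N. gbin Q N j * w (int j)) + (\<Sum>j\<le>N. gbin Q N j * (A * Q ^ N * w (int j)))"
      by (simp add: algebra_simps sum_distrib_left sum_distrib_right sum.distrib)
    also have "(\<Sum>j\<le>N. gbin Q N j * (A * Q ^ N * w (int j))) =
        (\<Sum>j\<le>N. Q ^ (N - j) * gbin Q N j * w (int (Suc j)))"
    proof (rule sum.cong)
      fix j assume "j \<in> {..N}"
      then have "nat (int N - int j) = N - j" "int j \<le> int N" by auto
      then have "A * Q ^ N * w (int j) = w (int (Suc j)) * Q ^ (N - j)"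
        using A[of "int j" N] by (simp add: add.commute)
      then show "gbin Q N j * (A * Q ^ N * w (int j)) = Q ^ (N - j) * gbin Q N j * w (int (Suc j))"
        by (simp only: mult_ac)
    qed simp
    also have "(\<Sum>j\<le>N. gbin Q N j * w (int j)) = (\<Sum>j\<le>Suc N. gbin Q N j * w (int j))"
      by (simp add: gbin_def)
    also have "\<dots> = w 0 + (\<Sum>j\<le>N. gbin Q N (Suc j) * w (int (Suc j)))"
      unfolding sum.atMost_Suc_shift by (simp add: gbin_0)
    finally have "(\<Prod>k<Suc N. 1 + A * Q ^ k) =
       w 0 + (\<Sum>j\<le>N. (Q ^ (N - j) * gbin Q N j + gbin Q N (Suc j)) * w (int (Suc j)))"
      by (simp add: sum.distrib algebra_simps)
    also have "\<dots> = w 0 + (\<Sum>j\<le>N. gbin Q (Suc N) (Suc j) * w (int (Suc j)))"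
      by (simp add: gbin_Suc_Suc')
    also have "\<dots> = (\<Sum>j\<le>Suc N. gbin Q (Suc N) j * w (int j))"
      unfolding sum.atMost_Suc_shift by (simp add: gbin_0)
    finally show ?case by simp
  qed
next
  \<comment> \<open>A new \<open>B\<close> factor lowers the index of the weights by one; counted
    from \<open>- Suc L\<close>, the coefficients merge by \<open>gbin_Suc_Suc\<close>.\<close>
  case (Suc L)
  define M where "M = N + L"
  have "(\<Prod>k<N. 1 + A * Q ^ k) * (\<Prod>k<Suc L. 1 + B * Q ^ k) =
      (\<Sum>j\<le>M. gbin Q M j * w (int j - int L)) * (1 + B * Q ^ L)"
    using Suc by (simp add: M_def mult.assoc[symmetric])
  also have "\<dots> = (\<Sum>j\<le>M. gbin Q M j * w (int j - int L)) + (\<Sum>j\<le>M. gbin Q M j * (B * Q ^ L * w (int j - int L)))"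
    by (simp add: algebra_simps sum_distrib_left sum_distrib_right sum.distrib)
  also have "(\<Sum>j\<le>M. gbin Q M j * (B * Q ^ L * w (int j - int L))) =
      (\<Sum>j\<le>M. Q ^ j * gbin Q M j * w (int j - int (Suc L)))"
  proof (rule sum.cong)
    fix j assume "j \<in> {..M}"
    have "B * Q ^ L * w (int j - int L) = w (int j - int L - 1) * Q ^ nat (int L + (int j - int L))"
      by (rule B) simp
    moreover have "int j - int L - 1 = int j - int (Suc L)" by simp
    ultimately show "gbin Q M j * (B * Q ^ L * w (int j - int L)) = Q ^ j * gbin Q M j * w (int j - int (Suc L))"
      by (simp add: mult_ac)
  qed simp
  also have "\<dots> = (\<Sum>j\<le>Suc M. Q ^ j * gbin Q M j * w (int j - int (Suc L)))"
    by (simp add: gbin_def)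
  also have "\<dots> = w (- int (Suc L)) + (\<Sum>j\<le>M. Q ^ Suc j * gbin Q M (Suc j) * w (int j - int L))"
    unfolding sum.atMost_Suc_shift by (simp add: gbin_0)
  finally have "(\<Prod>k<N. 1 + A * Q ^ k) * (\<Prod>k<Suc L. 1 + B * Q ^ k) =
      w (- int (Suc L)) + (\<Sum>j\<le>M. gbin Q (Suc M) (Suc j) * w (int j - int L))"
    by (simp only: gbin_Suc_Suc) (simp add: sum.distrib algebra_simps)
  also have "\<dots> = (\<Sum>j\<le>Suc M. gbin Q (Suc M) j * w (int j - int (Suc L)))"
    unfolding sum.atMost_Suc_shift by (simp add: gbin_0)
  finally show ?case by (simp add: M_def)
qed

end

section \<open>Integer powers of a unit and the exponents of theta series\<close>

definition upow :: "'a::comm_ring_1 \<Rightarrow> 'a \<Rightarrow> int \<Rightarrow> 'a" where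
  "upow z zi n = (if 0 \<le> n then z ^ nat n else zi ^ nat (- n))"

lemma upow_0: "upow z zi 0 = 1"
  by (simp add: upow_def)

lemma upow_Suc:
  assumes "z * zi = 1"
  shows "upow z zi (n + 1) = z * upow z zi n"
proof -
  consider "0 \<le> n" | "n = -1" | "n < -1" by linarith
  then show ?thesis
  proof cases
    case 1
    then have "nat (n + 1) = Suc (nat n)" by simp
    then show ?thesis using 1 by (simp add: upow_def)
  next
    case 3
    then have "nat (- n) = Suc (nat (- (n + 1)))" by simp
    then have "z * upow z zi n = z * zi * upow z zi (n + 1)"
      using 3 by (simp add: upow_def)
    then show ?thesis using assms by simp
  qed (use assms in \<open>simp add: upow_def\<close>)
qed

lemma upow_pred:
  assumes "z * zi = 1"
  shows "upow z zi (n - 1) = zi * upow z zi n"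
proof -
  have "zi * upow z zi n = zi * (z * upow z zi (n - 1))"
    using upow_Suc[OF assms, of "n - 1"] by simp
  also have "\<dots> = z * zi * upow z zi (n - 1)" by (simp only: mult_ac)
  finally show ?thesis using assms by simp
qed

lemma upow_add:
  assumes "z * zi = 1"
  shows "upow z zi (m + n) = upow z zi m * upow z zi n"
proof (induction n rule: int_induct[where k = 0])
  case base
  then show ?case by (simp add: upow_0)
next
  case (step1 i)
  then show ?case using upow_Suc[OF assms, of "m + i"] upow_Suc[OF assms, of i]
    by (simp add: add.assoc[symmetric] mult_ac)
next
  case (step2 i)
  then show ?case using upow_pred[OF assms, of "m + i"] upow_pred[OF assms, of i]
    by (simp add: add_diff_eq mult_ac)
qed

lemma upow_1: "upow 1 1 n = 1"
  by (simp add: upow_def)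

text \<open>
  The generating function of the weights \<open>c i\<close> placed in degree \<open>e i\<close>. It is meaningful only if
  \<open>e\<close> is nonnegative with finite fibres: terms of negative degree are dropped, and infinite fibres
  contribute \<open>0\<close>.
\<close>

definition gsum :: "('i \<Rightarrow> 'a::comm_ring_1) \<Rightarrow> ('i \<Rightarrow> int) \<Rightarrow> 'a fps" where
  "gsum c e = Abs_fps (\<lambda>N. \<Sum>i | e i = int N. c i)"

text \<open>The exponent of \<open>q\<close> in \<open>A^n Q^(n(n-1)/2)\<close> for
  \<open>A = z q^a\<close> and \<open>Q = q^m\<close>; the division is exact.\<close>

definition jexp :: "nat \<Rightarrow> nat \<Rightarrow> int \<Rightarrow> int" where
  "jexp m a n = int m * (n * (n - 1) div 2) + int a * n"

lemma jexp_0: "jexp m a 0 = 0"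
  by (simp add: jexp_def)

lemma two_jexp: "2 * jexp m a n = int m * (n * (n - 1)) + 2 * int a * n"
proof -
  have "2 * (n * (n - 1) div 2) = n * (n - 1)" by simp
  then show ?thesis by (simp add: jexp_def algebra_simps)
qed

lemma jexp_Suc: "jexp m a (n + 1) = jexp m a n + int m * n + int a"
  using two_jexp[of m a n] two_jexp[of m a "n + 1"] by (simp add: algebra_simps)

lemma jexp_pred: "jexp m a (n - 1) = jexp m a n - int m * n + int m - int a"
  using two_jexp[of m a n] two_jexp[of m a "n - 1"] by (simp add: algebra_simps)

text \<open>Each step away from \<open>0\<close> adds at least \<open>1\<close>:
  \<open>m * n + a\<close> upwards, \<open>m - a - m * n\<close> downwards. Nonnegativity and finite
  fibres both follow from this bound.\<close>

lemma abs_le_jexp: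
  assumes "0 < a" "a < m"
  shows "\<bar>n\<bar> \<le> jexp m a n"
proof (induction n rule: int_induct[where k = 0])
  case base
  then show ?case by (simp add: jexp_0)
next
  case (step1 i)
  have "0 \<le> int m * i" using step1 by simp
  then show ?case using step1 assms jexp_Suc[of m a i] by linarith
next
  case (step2 i)
  have "0 \<le> int m * (- i)" using step2 by (intro mult_nonneg_nonneg) auto
  then show ?case using step2 assms jexp_pred[of m a i] by simp
qed

text \<open>The finite triple product is multiplied by \<open>(Q;Q)_N\<close>. Modulo
  \<open>q^d\<close> the central coefficients then become \<open>1\<close>, while the outer weights
  vanish.\<close>

lemma jacobi_triple_product:
  fixes z zi :: "'a::comm_ring_1"
  assumes z: "z * zi = 1" and a: "0 < a" "a < m"
  shows "qp (- z) a m * qp (- zi) (m - a) m * qp 1 m m = gsum (upow z zi) (jexp m a)"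
proof (rule fps_eq_by_dvd)
  fix d :: nat
  define Q :: "'a fps" where "Q = fps_X ^ m"
  define A where "A = fps_const z * fps_X ^ a"
  define B where "B = fps_const zi * fps_X ^ (m - a)"
  define w where "w = (\<lambda>n. fps_const (upow z zi n) * fps_X ^ nat (jexp m a n))"
  \<comment> \<open>With this choice, an index \<open>j\<close> closer than \<open>d\<close> to
    either end of \<open>0..2N\<close> is more than \<open>d\<close> away from \<open>N\<close>, so
    its weight has degree at least \<open>d\<close>.\<close>
  define N where "N = 2 * d"
  have Q0: "fps_nth Q 0 = 0" using a by (simp add: Q_def fps_X_power_iff)
  have nn: "0 \<le> jexp m a n" for n using abs_le_jexp[OF a, of n] by linarith
  have hA: "A * Q ^ K * w n = w (n + 1) * Q ^ nat (int K - n)" if "n \<le> int K" for K n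
  proof -
    have "int (a + m * K + nat (jexp m a n)) = int (nat (jexp m a (n + 1)) + m * nat (int K - n))"
      using nn[of n] nn[of "n + 1"] that jexp_Suc[of m a n] by (simp add: algebra_simps)
    then have "a + m * K + nat (jexp m a n) = nat (jexp m a (n + 1)) + m * nat (int K - n)"
      by (simp only: of_nat_eq_iff)
    then have *: "fps_X ^ a * Q ^ K * fps_X ^ nat (jexp m a n) =
        fps_X ^ nat (jexp m a (n + 1)) * Q ^ nat (int K - n)"
      by (simp add: Q_def power_mult[symmetric] power_add[symmetric])
    have "A * Q ^ K * w n = fps_const z * fps_const (upow z zi n) *
        (fps_X ^ a * Q ^ K * fps_X ^ nat (jexp m a n))"
      by (simp only: A_def w_def mult_ac)
    also have "\<dots> = w (n + 1) * Q ^ nat (int K - n)"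
      unfolding * by (simp add: w_def upow_Suc[OF z] mult.assoc)
    finally show ?thesis .
  qed
  have hB: "B * Q ^ K * w n = w (n - 1) * Q ^ nat (int K + n)" if "- n \<le> int K" for K n
  proof -
    have "int (m - a + m * K + nat (jexp m a n)) = int (nat (jexp m a (n - 1)) + m * nat (int K + n))"
      using nn[of n] nn[of "n - 1"] that a jexp_pred[of m a n] by (simp add: algebra_simps)
    then have "m - a + m * K + nat (jexp m a n) = nat (jexp m a (n - 1)) + m * nat (int K + n)"
      by (simp only: of_nat_eq_iff)
    then have *: "fps_X ^ (m - a) * Q ^ K * fps_X ^ nat (jexp m a n) =
        fps_X ^ nat (jexp m a (n - 1)) * Q ^ nat (int K + n)"
      by (simp add: Q_def power_mult[symmetric] power_add[symmetric])
    have "B * Q ^ K * w n = fps_const zi * fps_const (upow z zi n) *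
        (fps_X ^ (m - a) * Q ^ K * fps_X ^ nat (jexp m a n))"
      by (simp only: B_def w_def mult_ac)
    also have "\<dots> = w (n - 1) * Q ^ nat (int K + n)"
      unfolding * by (simp add: w_def upow_pred[OF z] mult.assoc)
    finally show ?thesis .
  qed
  have w0: "w 0 = 1" by (simp add: w_def upow_0 jexp_0)
  have facA: "qpfac (- z) a m k = 1 + A * Q ^ k" for k
    by (simp add: A_def Q_def power_add power_mult fps_const_neg[symmetric] mult.assoc del: fps_const_neg)
  have facB: "qpfac (- zi) (m - a) m k = 1 + B * Q ^ k" for k
    by (simp add: B_def Q_def power_add power_mult fps_const_neg[symmetric] mult.assoc del: fps_const_neg)
  have facQ: "(\<Prod>k<n. qpfac 1 m m k) = qfac Q n" for n
    by (simp add: qfac_def Q_def power_add power_mult)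
  have "fps_X ^ d dvd qp (- z) a m * qp (- zi) (m - a) m * qp 1 m m -
      (\<Prod>k<N. qpfac (- z) a m k) * (\<Prod>k<N. qpfac (- zi) (m - a) m k) * (\<Prod>k<N. qpfac 1 m m k)"
    by (intro dvd_diff_mult_cong qp_approx) (use a in \<open>auto simp: N_def\<close>)
  also have "(\<Prod>k<N. qpfac (- z) a m k) * (\<Prod>k<N. qpfac (- zi) (m - a) m k) * (\<Prod>k<N. qpfac 1 m m k)
      = (\<Sum>j\<le>N + N. gbin Q (N + N) j * w (int j - int N)) * qfac Q N"
    unfolding facA facB facQ by (subst finite_triple_product[of Q A w B, OF Q0 hA hB w0]) simp_all
  also have "\<dots> = (\<Sum>j\<le>N + N. (qfac Q N * gbin Q (N + N) j) * w (int j - int N))"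
    by (simp add: sum_distrib_left sum_distrib_right mult_ac)
  finally have 1: "fps_X ^ d dvd qp (- z) a m * qp (- zi) (m - a) m * qp 1 m m -
      (\<Sum>j\<le>N + N. (qfac Q N * gbin Q (N + N) j) * w (int j - int N))" .
  have qf: "fps_X ^ d dvd qfac Q n - qfac Q n'" if "d \<le> n" "d \<le> n'" for n n'
    unfolding facQ[symmetric]
    by (rule dvd_diff_trans2[of _ _ "qp 1 m m"]; subst minus_diff_eq[symmetric], subst dvd_minus_iff,
        rule qp_approx) (use a that in auto)
  \<comment> \<open>In \<open>(Q;Q)_N (Q;Q)_{2N} / ((Q;Q)_j (Q;Q)_{2N-j})\<close> all indices are at
    least \<open>d\<close>, so the factors agree modulo \<open>q^d\<close> and cancel.\<close>
  have gb: "fps_X ^ d dvd qfac Q N * gbin Q (N + N) j - 1" if j: "j \<le> N + N" "d \<le> j" "d \<le> N + N - j" for j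
  proof -
    have "fps_X ^ d dvd qfac Q N * (qfac Q (N + N) * (qfac_inv Q j * qfac_inv Q (N + N - j))) -
       qfac Q j * (qfac Q (N + N - j) * (qfac_inv Q j * qfac_inv Q (N + N - j)))"
      by (intro dvd_diff_mult_cong qf) (use j in \<open>auto simp: N_def\<close>)
    also have "qfac Q j * (qfac Q (N + N - j) * (qfac_inv Q j * qfac_inv Q (N + N - j))) =
        (qfac Q j * qfac_inv Q j) * (qfac Q (N + N - j) * qfac_inv Q (N + N - j))"
      by (simp only: mult_ac)
    finally show ?thesis using j by (simp add: gbin_def qfac_mult_inv[OF Q0])
  qed
  have "fps_X ^ d dvd (qfac Q N * gbin Q (N + N) j) * w (int j - int N) - w (int j - int N)"
    if "j \<le> N + N" for j
  proof (cases "d \<le> j \<and> d \<le> N + N - j")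
    case True
    then have "fps_X ^ d dvd (qfac Q N * gbin Q (N + N) j - 1) * w (int j - int N)"
      using gb that by (intro dvd_mult2) auto
    then show ?thesis by (simp add: algebra_simps)
  next
    case False
    then have "int d \<le> \<bar>int j - int N\<bar>" using that by (auto simp: N_def)
    also have "\<dots> \<le> jexp m a (int j - int N)" by (rule abs_le_jexp[OF a])
    finally have "d \<le> nat (jexp m a (int j - int N))" by simp
    then have "fps_X ^ d dvd w (int j - int N)"
      unfolding w_def by (intro dvd_mult le_imp_power_dvd)
    then show ?thesis by (intro dvd_diff dvd_mult)
  qed
  then have 2: "fps_X ^ d dvd (\<Sum>j\<le>N + N. (qfac Q N * gbin Q (N + N) j) * w (int j - int N)) -
      (\<Sum>j\<le>N + N. w (int j - int N))"
    unfolding sum_subtractf[symmetric] by (intro dvd_sum) auto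
  have 3: "(\<Sum>j\<le>N + N. w (int j - int N)) = (\<Sum>n\<in>{- int N..int N}. w n)"
    by (rule sum.reindex_bij_witness[where i = "\<lambda>n. nat (n + int N)" and j = "\<lambda>j. int j - int N"]) auto
  have 4: "fps_X ^ d dvd (\<Sum>n\<in>{- int N..int N}. w n) - gsum (upow z zi) (jexp m a)"
    unfolding fps_X_power_dvd_iff
  proof (intro allI impI)
    fix i assume i: "i < d"
    have "fps_nth (\<Sum>n\<in>{- int N..int N}. w n) i = (\<Sum>n\<in>{- int N..int N}. if jexp m a n = int i then upow z zi n else 0)"
      unfolding fps_sum_nth
      by (intro sum.cong) (use nn in \<open>auto simp: w_def fps_X_power_iff nat_eq_iff2\<close>)
    also have "\<dots> = (\<Sum>n | n \<in> {- int N..int N} \<and> jexp m a n = int i. upow z zi n)"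
      by (rule sum.inter_filter[symmetric]) simp
    \<comment> \<open>By \<open>abs_le_jexp\<close>, an index of exponent \<open>i < d\<close>
      already lies in the window.\<close>
    also have "{n. n \<in> {- int N..int N} \<and> jexp m a n = int i} = {n. jexp m a n = int i}"
    proof (intro equalityI subsetI)
      fix n assume "n \<in> {n. jexp m a n = int i}"
      then show "n \<in> {n. n \<in> {- int N..int N} \<and> jexp m a n = int i}"
        using i abs_le_jexp[OF a, of n] by (auto simp: N_def)
    qed auto
    finally show "fps_nth ((\<Sum>n\<in>{- int N..int N}. w n) - gsum (upow z zi) (jexp m a)) i = 0"
      by (simp add: gsum_def)
  qed
  show "fps_X ^ d dvd qp (- z) a m * qp (- zi) (m - a) m * qp 1 m m - gsum (upow z zi) (jexp m a)"
    using dvd_diff_trans[OF 1 dvd_diff_trans[OF 2[unfolded 3] 4]] .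
qed

subsection \<open>Dissections of double theta series\<close>

definition adm :: "('i \<Rightarrow> int) \<Rightarrow> bool" where
  "adm e \<longleftrightarrow> (\<forall>i. 0 \<le> e i) \<and> (\<forall>N. finite {i. e i = N})"

lemma adm_jexp:
  assumes "0 < a" "a < m"
  shows "adm (jexp m a)"
  unfolding adm_def
proof (intro conjI allI)
  fix N n
  show "0 \<le> jexp m a n" using abs_le_jexp[OF assms, of n] by linarith
  show "finite {i. jexp m a i = N}"
  proof (rule finite_subset)
    show "{i. jexp m a i = N} \<subseteq> {- N..N}"
    proof
      fix i assume "i \<in> {i. jexp m a i = N}"
      then show "i \<in> {- N..N}" using abs_le_jexp[OF assms, of i] by auto
    qed
  qed simp
qed

lemma adm_plus:
  assumes e: "adm e" "adm e'"
  shows "adm (\<lambda>(i, j). e i + e' j)"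
  unfolding adm_def
proof (intro conjI allI)
  fix N p
  show "0 \<le> (\<lambda>(i, j). e i + e' j) p" using e by (cases p) (simp add: adm_def)
  have "{p. (\<lambda>(i, j). e i + e' j) p = N} \<subseteq> (\<Union>k\<in>{0..N}. {i. e i = k} \<times> {j. e' j = N - k})"
    using e by (auto simp: adm_def)
  moreover have "finite \<dots>" using e by (auto simp: adm_def)
  ultimately show "finite {p. (\<lambda>(i, j). e i + e' j) p = N}" by (rule finite_subset)
qed

lemma adm_double:
  assumes "adm e"
  shows "adm (\<lambda>i. 2 * e i)"
  unfolding adm_def
proof (intro conjI allI)
  fix N i
  show "0 \<le> 2 * e i" using assms by (simp add: adm_def)
  have "{i. 2 * e i = N} \<subseteq> {i. e i = N div 2}" by auto
  then show "finite {i. 2 * e i = N}" using assms unfolding adm_def by (meson finite_subset)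
qed

text \<open>Cauchy product: the fibre of the summed exponent over \<open>N\<close> is the disjoint
  union of products of the fibres over \<open>k\<close> and \<open>N - k\<close>.\<close>

lemma gsum_mult:
  assumes e: "adm e" "adm e'"
  shows "gsum c e * gsum c' e' = gsum (\<lambda>(i, j). c i * c' j) (\<lambda>(i, j). e i + e' j)"
proof (rule fps_ext)
  fix N
  have "fps_nth (gsum c e * gsum c' e') N =
      (\<Sum>k\<in>{0..N}. (\<Sum>i | e i = int k. c i) * (\<Sum>j | e' j = int (N - k). c' j))"
    by (simp add: fps_mult_nth gsum_def)
  also have "\<dots> = (\<Sum>k\<in>{0..N}. \<Sum>(i, j)\<in>{i. e i = int k} \<times> {j. e' j = int (N - k)}. c i * c' j)"
    by (simp add: sum_product sum.cartesian_product)
  also have "\<dots> = (\<Sum>(i, j)\<in>(\<Union>k\<in>{0..N}. {i. e i = int k} \<times> {j. e' j = int (N - k)}). c i * c' j)"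
    by (rule sum.UNION_disjoint[symmetric]) (use e in \<open>auto simp: adm_def\<close>)
  also have "(\<Union>k\<in>{0..N}. {i. e i = int k} \<times> {j. e' j = int (N - k)}) =
      {p. (\<lambda>(i, j). e i + e' j) p = int N}" (is "?L = ?R")
  proof
    show "?R \<subseteq> ?L"
    proof
      fix p assume "p \<in> ?R"
      then obtain i j where p: "p = (i, j)" "e i + e' j = int N" by (cases p) auto
      have "0 \<le> e i" "0 \<le> e' j" using e by (auto simp: adm_def)
      then have "nat (e i) \<in> {0..N}" "e i = int (nat (e i))" "e' j = int (N - nat (e i))"
        using p by auto
      then show "p \<in> ?L" using p(1) by blast
    qed
  qed auto
  finally show "fps_nth (gsum c e * gsum c' e') N =
      fps_nth (gsum (\<lambda>(i, j). c i * c' j) (\<lambda>(i, j). e i + e' j)) N"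
    by (simp add: gsum_def)
qed

text \<open>\<open>h1\<close> and \<open>h2\<close> parametrize two complementary parts of the index
  set; the applications separate index pairs by parity.\<close>

lemma gsum_split:
  assumes e: "adm e"
    and h: "inj h1" "inj h2" "\<And>p p'. h1 p \<noteq> h2 p'" "\<And>i. (\<exists>p. i = h1 p) \<or> (\<exists>p. i = h2 p)"
    and c1: "\<And>p. c (h1 p) = c1 p" and e1: "\<And>p. e (h1 p) = e1 p"
    and c2: "\<And>p. c (h2 p) = c2 p" and e2: "\<And>p. e (h2 p) = e2 p"
  shows "gsum c e = gsum c1 e1 + gsum c2 e2"
proof (rule fps_ext)
  fix N
  have *: "{i. e i = int N} = h1 ` {p. e1 p = int N} \<union> h2 ` {p. e2 p = int N}" (is "?L = ?R")
  proof
    show "?L \<subseteq> ?R"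
    proof
      fix i assume i: "i \<in> ?L"
      from h(4)[of i] show "i \<in> ?R"
        using i e1 e2 by (elim disjE exE) auto
    qed
  qed (use e1 e2 in auto)
  have "finite {i. e i = int N}" using e by (simp add: adm_def)
  then have fin: "finite (h1 ` {p. e1 p = int N})" "finite (h2 ` {p. e2 p = int N})"
    unfolding * by auto
  have "(\<Sum>i | e i = int N. c i) = sum c (h1 ` {p. e1 p = int N}) + sum c (h2 ` {p. e2 p = int N})"
    unfolding * by (rule sum.union_disjoint) (use fin h(3) in auto)
  also have "\<dots> = (\<Sum>p | e1 p = int N. c1 p) + (\<Sum>p | e2 p = int N. c2 p)"
    using h(1,2) by (simp add: sum.reindex inj_on_subset c1 c2)
  finally show "fps_nth (gsum c e) N = fps_nth (gsum c1 e1 + gsum c2 e2) N"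
    by (simp add: gsum_def)
qed

lemma gsum_Suc:
  assumes "adm e"
  shows "gsum c (\<lambda>i. e i + 1) = fps_X * gsum c e"
proof (rule fps_ext)
  fix N
  show "fps_nth (gsum c (\<lambda>i. e i + 1)) N = fps_nth (fps_X * gsum c e) N"
  proof (cases N)
    case 0
    have "e i + 1 \<noteq> 0" for i using assms unfolding adm_def by (metis add_nonneg_pos less_irrefl zero_less_one)
    then show ?thesis using 0 by (simp add: gsum_def)
  next
    case (Suc M)
    have "{i. e i + 1 = int N} = {i. e i = int M}" using Suc by auto
    then show ?thesis using Suc by (simp add: gsum_def)
  qed
qed

lemma gsum_dil: "gsum c (\<lambda>i. 2 * e i) = dil (gsum c e)"
proof (rule fps_ext)
  fix N
  show "fps_nth (gsum c (\<lambda>i. 2 * e i)) N = fps_nth (dil (gsum c e)) N"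
  proof (cases "even N")
    case True
    then obtain M where M: "N = 2 * M" by (elim evenE)
    have "{i. 2 * e i = int N} = {i. e i = int M}" using M by auto
    then show ?thesis using M by (simp add: gsum_def dil_def)
  next
    case False
    have "2 * e i \<noteq> int N" for i using False by presburger
    then show ?thesis using False by (simp add: gsum_def dil_def)
  qed
qed

section \<open>Explicit exponents and the three dissections\<close>

lemma jexp_even:
  "jexp 2 a n = n * (n - 1) + int a * n"
  "jexp 4 a n = 2 * (n * (n - 1)) + int a * n"
  "jexp 6 a n = 3 * (n * (n - 1)) + int a * n"
  "jexp 8 a n = 4 * (n * (n - 1)) + int a * n"
  "jexp 12 a n = 6 * (n * (n - 1)) + int a * n"
  "jexp 24 a n = 12 * (n * (n - 1)) + int a * n"
  using two_jexp[of 2 a n] two_jexp[of 4 a n] two_jexp[of 6 a n] two_jexp[of 8 a n]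
    two_jexp[of 12 a n] two_jexp[of 24 a n]
  by simp_all

text \<open>This exponent is \<open>jexp 6 6\<close>, outside the range \<open>a < m\<close> of
  \<open>adm_jexp\<close>. It vanishes at both \<open>0\<close> and \<open>-1\<close>, hence the
  weaker bound by \<open>\<bar>n\<bar> - 1\<close>.\<close>

lemma adm_pronic: "adm (\<lambda>n. 3 * (n * (n + 1)))"
  unfolding adm_def
proof (intro conjI allI)
  have bound: "\<bar>n\<bar> - 1 \<le> n * (n + 1)" and nonneg: "0 \<le> n * (n + 1)" for n :: int
  proof -
    consider "0 \<le> n" | "n = -1" | "n < -1" by linarith
    then have "\<bar>n\<bar> - 1 \<le> n * (n + 1) \<and> 0 \<le> n * (n + 1)"
    proof cases
      case 1
      then have "0 \<le> n * n" by simp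
      then show ?thesis using 1 by (simp add: algebra_simps)
    next
      case 3
      then have "0 \<le> (- n - 1) * (- n - 1)" "0 \<le> n * (n + 1)" by (auto intro: mult_nonpos_nonpos)
      then show ?thesis using 3 by (simp add: algebra_simps)
    qed auto
    then show "\<bar>n\<bar> - 1 \<le> n * (n + 1)" "0 \<le> n * (n + 1)" by auto
  qed
  fix N n :: int
  show "0 \<le> 3 * (n * (n + 1))" using nonneg[of n] by linarith
  have "{n. 3 * (n * (n + 1)) = N} \<subseteq> {- \<bar>N\<bar> - 1..\<bar>N\<bar> + 1}"
  proof
    fix n assume "n \<in> {n. 3 * (n * (n + 1)) = N}"
    then have "3 * (n * (n + 1)) = N" by simp
    then show "n \<in> {- \<bar>N\<bar> - 1..\<bar>N\<bar> + 1}" using bound[of n] by auto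
  qed
  then show "finite {n. 3 * (n * (n + 1)) = N}" by (rule finite_subset) simp
qed

text \<open>
  In the notation of the introduction, \<open>\<phi>(q^i)\<close> is \<open>jser (2 * i) i\<close>, \<open>\<psi>(q^i)\<close> is \<open>jser (4 * i) (3 * i)\<close>,
  \<open>\<alpha>\<close> is \<open>jser 6 5\<close> and \<open>\<beta>\<close> is \<open>jser 6 2\<close>.
\<close>

definition jser :: "nat \<Rightarrow> nat \<Rightarrow> 'a::comm_ring_1 fps" where
  "jser m a = gsum (\<lambda>n. 1) (jexp m a)"

lemma jser_eq:
  assumes "0 < a" "a < m"
  shows "jser m a = qp (- 1) a m * qp (- 1) (m - a) m * (qp 1 m m :: 'a::comm_ring_1 fps)"
proof -
  have "upow 1 1 = (\<lambda>n. 1 :: 'a)" by (simp add: fun_eq_iff upow_1)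
  then show ?thesis
    using jacobi_triple_product[of "1 :: 'a" 1 a m] assms by (simp add: jser_def)
qed

text \<open>The index pair is replaced by half its sum and half its difference. The sum carries all
  powers of \<open>z\<close>, and the cross terms cancel because both exponents have the same
  quadratic part. The parity of the sum yields the two summands.\<close>

lemma theta_quad3_split:
  fixes z zi :: "'a::comm_ring_1"
  assumes z: "z * zi = 1"
  shows "gsum (upow z zi) (jexp 3 1) * gsum (upow z zi) (jexp 3 2) =
    gsum (\<lambda>n. upow z zi (2 * n)) (jexp 6 3) * jser 6 2 +
    fps_X * (gsum (\<lambda>n. upow z zi (2 * n + 1)) (\<lambda>n. 3 * (n * (n + 1))) * jser 6 5)"
proof -
  let ?h1 = "\<lambda>(a, b). (a + b, a - b) :: int \<times> int"
  let ?h2 = "\<lambda>(a, b). (a + b + 1, a - b) :: int \<times> int"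
  have "gsum (upow z zi) (jexp 3 1) * gsum (upow z zi) (jexp 3 2) =
      gsum (\<lambda>(i, j). upow z zi i * upow z zi j) (\<lambda>(i, j). jexp 3 1 i + jexp 3 2 j)"
    by (rule gsum_mult) (auto intro: adm_jexp)
  also have "\<dots> = gsum (\<lambda>(a, b). upow z zi (2 * a) * 1) (\<lambda>(a, b). jexp 6 3 a + jexp 6 2 b) +
      gsum (\<lambda>(a, b). upow z zi (2 * a + 1) * 1) (\<lambda>p. (case p of (a, b) \<Rightarrow> 3 * (a * (a + 1)) + jexp 6 5 b) + 1)"
  proof (rule gsum_split[where ?h1.0 = ?h1 and ?h2.0 = ?h2])
    show "adm (\<lambda>(i, j). jexp 3 1 i + jexp 3 2 j)" by (intro adm_plus adm_jexp) auto
    show "inj ?h1" "inj ?h2" by (auto simp: inj_def)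
    show "?h1 p \<noteq> ?h2 p'" for p p' by (cases p; cases p') (simp, presburger)
    show "(\<exists>p. i = ?h1 p) \<or> (\<exists>p. i = ?h2 p)" for i
    proof -
      obtain n m where i: "i = (n, m)" by (cases i)
      show ?thesis
      proof (cases "even (n + m)")
        case True
        then have "i = ?h1 ((n + m) div 2, (n - m) div 2)" using i by (simp, presburger)
        then show ?thesis by blast
      next
        case False
        then have "i = ?h2 ((n + m - 1) div 2, (n - m - 1) div 2)" using i by (simp, presburger)
        then show ?thesis by blast
      qed
    qed
    fix p :: "int \<times> int"
    obtain a b where p: "p = (a, b)" by (cases p)
    have "a + b + (a - b) = 2 * a" "a + b + 1 + (a - b) = 2 * a + 1" by auto
    then show "(case ?h1 p of (i, j) \<Rightarrow> upow z zi i * upow z zi j) = (case p of (a, b) \<Rightarrow> upow z zi (2 * a) * 1)"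
      "(case ?h2 p of (i, j) \<Rightarrow> upow z zi i * upow z zi j) = (case p of (a, b) \<Rightarrow> upow z zi (2 * a + 1) * 1)"
      unfolding p by (simp_all add: upow_add[OF z, symmetric])
    show "(case ?h1 p of (i, j) \<Rightarrow> jexp 3 1 i + jexp 3 2 j) = (case p of (a, b) \<Rightarrow> jexp 6 3 a + jexp 6 2 b)"
      using two_jexp[of 3 1 "a + b"] two_jexp[of 3 2 "a - b"] two_jexp[of 6 3 a] two_jexp[of 6 2 b]
      unfolding p by (simp add: algebra_simps)
    show "(case ?h2 p of (i, j) \<Rightarrow> jexp 3 1 i + jexp 3 2 j) =
        (case p of (a, b) \<Rightarrow> 3 * (a * (a + 1)) + jexp 6 5 b) + 1"
      using two_jexp[of 3 1 "a + b + 1"] two_jexp[of 3 2 "a - b"] two_jexp[of 6 5 b]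
      unfolding p by (simp add: algebra_simps)
  qed
  also have "gsum (\<lambda>(a, b). upow z zi (2 * a) * 1) (\<lambda>(a, b). jexp 6 3 a + jexp 6 2 b) =
      gsum (\<lambda>n. upow z zi (2 * n)) (jexp 6 3) * jser 6 2"
    unfolding jser_def by (rule gsum_mult[symmetric]) (auto intro: adm_jexp)
  also have "gsum (\<lambda>(a, b). upow z zi (2 * a + 1) * 1) (\<lambda>p. (case p of (a, b) \<Rightarrow> 3 * (a * (a + 1)) + jexp 6 5 b) + 1) =
      fps_X * gsum (\<lambda>(a, b). upow z zi (2 * a + 1) * 1) (\<lambda>(a, b). 3 * (a * (a + 1)) + jexp 6 5 b)"
    by (intro gsum_Suc adm_plus adm_pronic adm_jexp) auto
  also have "gsum (\<lambda>(a, b). upow z zi (2 * a + 1) * 1) (\<lambda>(a, b). 3 * (a * (a + 1)) + jexp 6 5 b) =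
      gsum (\<lambda>n. upow z zi (2 * n + 1)) (\<lambda>n. 3 * (n * (n + 1))) * jser 6 5"
    unfolding jser_def by (rule gsum_mult[symmetric]) (auto intro: adm_jexp adm_pronic)
  finally show ?thesis .
qed

text \<open>The same change of indices gives the same two series in \<open>z\<close>, but
  \<open>jser 6 5\<close> and \<open>jser 6 2\<close> have exchanged places. The sign of
  \<open>b\<close> makes the even part come out as \<open>jexp 6 5\<close> and not
  \<open>jexp 6 1\<close>.\<close>

lemma theta_quad6_split:
  fixes z zi :: "'a::comm_ring_1"
  assumes z: "z * zi = 1"
  shows "gsum (upow z zi) (jexp 6 1) * gsum (upow z zi) (jexp 6 5) =
    dil (gsum (\<lambda>n. upow z zi (2 * n)) (jexp 6 3) * jser 6 5) +
    fps_X * dil (gsum (\<lambda>n. upow z zi (2 * n + 1)) (\<lambda>n. 3 * (n * (n + 1))) * jser 6 2)"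
proof -
  let ?h1 = "\<lambda>(a, b). (a - b, a + b) :: int \<times> int"
  let ?h2 = "\<lambda>(a, b). (a - b + 1, a + b) :: int \<times> int"
  have "gsum (upow z zi) (jexp 6 1) * gsum (upow z zi) (jexp 6 5) =
      gsum (\<lambda>(i, j). upow z zi i * upow z zi j) (\<lambda>(i, j). jexp 6 1 i + jexp 6 5 j)"
    by (rule gsum_mult) (auto intro: adm_jexp)
  also have "\<dots> = gsum (\<lambda>(a, b). upow z zi (2 * a) * 1) (\<lambda>p. 2 * (case p of (a, b) \<Rightarrow> jexp 6 3 a + jexp 6 5 b)) +
      gsum (\<lambda>(a, b). upow z zi (2 * a + 1) * 1) (\<lambda>p. 2 * (case p of (a, b) \<Rightarrow> 3 * (a * (a + 1)) + jexp 6 2 b) + 1)"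
  proof (rule gsum_split[where ?h1.0 = ?h1 and ?h2.0 = ?h2])
    show "adm (\<lambda>(i, j). jexp 6 1 i + jexp 6 5 j)" by (intro adm_plus adm_jexp) auto
    show "inj ?h1" "inj ?h2" by (auto simp: inj_def)
    show "?h1 p \<noteq> ?h2 p'" for p p' by (cases p; cases p') (simp, presburger)
    show "(\<exists>p. i = ?h1 p) \<or> (\<exists>p. i = ?h2 p)" for i
    proof -
      obtain n m where i: "i = (n, m)" by (cases i)
      show ?thesis
      proof (cases "even (n + m)")
        case True
        then have "i = ?h1 ((n + m) div 2, (m - n) div 2)" using i by (simp, presburger)
        then show ?thesis by blast
      next
        case False
        then have "i = ?h2 ((n + m - 1) div 2, (m - n + 1) div 2)" using i by (simp, presburger)
        then show ?thesis by blast
      qed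
    qed
    fix p :: "int \<times> int"
    obtain a b where p: "p = (a, b)" by (cases p)
    have "a - b + (a + b) = 2 * a" "a - b + 1 + (a + b) = 2 * a + 1" by auto
    then show "(case ?h1 p of (i, j) \<Rightarrow> upow z zi i * upow z zi j) = (case p of (a, b) \<Rightarrow> upow z zi (2 * a) * 1)"
      "(case ?h2 p of (i, j) \<Rightarrow> upow z zi i * upow z zi j) = (case p of (a, b) \<Rightarrow> upow z zi (2 * a + 1) * 1)"
      unfolding p by (simp_all add: upow_add[OF z, symmetric])
    show "(case ?h1 p of (i, j) \<Rightarrow> jexp 6 1 i + jexp 6 5 j) = 2 * (case p of (a, b) \<Rightarrow> jexp 6 3 a + jexp 6 5 b)"
      unfolding p by (simp add: jexp_even algebra_simps)
    show "(case ?h2 p of (i, j) \<Rightarrow> jexp 6 1 i + jexp 6 5 j) =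
        2 * (case p of (a, b) \<Rightarrow> 3 * (a * (a + 1)) + jexp 6 2 b) + 1"
      unfolding p by (simp add: jexp_even algebra_simps)
  qed
  also have "gsum (\<lambda>(a, b). upow z zi (2 * a) * 1) (\<lambda>p. 2 * (case p of (a, b) \<Rightarrow> jexp 6 3 a + jexp 6 5 b)) =
      dil (gsum (\<lambda>(a, b). upow z zi (2 * a) * 1) (\<lambda>(a, b). jexp 6 3 a + jexp 6 5 b))"
    by (rule gsum_dil)
  also have "gsum (\<lambda>(a, b). upow z zi (2 * a) * 1) (\<lambda>(a, b). jexp 6 3 a + jexp 6 5 b) =
      gsum (\<lambda>n. upow z zi (2 * n)) (jexp 6 3) * jser 6 5"
    unfolding jser_def by (rule gsum_mult[symmetric]) (auto intro: adm_jexp)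
  also have "gsum (\<lambda>(a, b). upow z zi (2 * a + 1) * 1) (\<lambda>p. 2 * (case p of (a, b) \<Rightarrow> 3 * (a * (a + 1)) + jexp 6 2 b) + 1) =
      fps_X * gsum (\<lambda>(a, b). upow z zi (2 * a + 1) * 1) (\<lambda>p. 2 * (case p of (a, b) \<Rightarrow> 3 * (a * (a + 1)) + jexp 6 2 b))"
    by (intro gsum_Suc adm_double adm_plus adm_pronic adm_jexp) auto
  also have "\<dots> = fps_X * dil (gsum (\<lambda>(a, b). upow z zi (2 * a + 1) * 1) (\<lambda>(a, b). 3 * (a * (a + 1)) + jexp 6 2 b))"
    by (simp only: gsum_dil)
  also have "gsum (\<lambda>(a, b). upow z zi (2 * a + 1) * 1) (\<lambda>(a, b). 3 * (a * (a + 1)) + jexp 6 2 b) =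
      gsum (\<lambda>n. upow z zi (2 * n + 1)) (\<lambda>n. 3 * (n * (n + 1))) * jser 6 2"
    unfolding jser_def by (rule gsum_mult[symmetric]) (auto intro: adm_jexp adm_pronic)
  finally show ?thesis .
qed

text \<open>
  Put \<open>d = n - m\<close> and \<open>r = 4 * m + d + 1\<close>; then \<open>2 * N + 1 = r^2 + 3 * d^2\<close> for the degree \<open>N\<close> of the
  term indexed by \<open>(n, m)\<close>. The case distinctions choose the signs of \<open>r\<close> and \<open>d\<close> so that
  \<open>\<plusminus>r \<equiv> 1 (mod 4)\<close> for even \<open>d\<close> and \<open>\<plusminus>d \<equiv> 1 (mod 4)\<close> for odd \<open>d\<close>.
\<close>

lemma psi_psi3_split:
  "jser 4 3 * jser 12 9 = dil (jser 6 3 * jser 8 6) + fps_X * dil (jser 2 1 * jser 24 18)"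
proof -
  \<comment> \<open>For \<open>d = 2 * k\<close>, \<open>m1\<close> solves
    \<open>\<plusminus>r = 4 * j + 1\<close> for \<open>m\<close>. For \<open>d = 2 * K + 1\<close>,
    \<open>k2\<close> solves \<open>\<plusminus>d = 4 * j + 1\<close> for \<open>K\<close>, and
    \<open>m2\<close> recovers \<open>m\<close> from \<open>r = 2 * t\<close>. The parity of
    \<open>t = 2 * m + K + 1\<close> fixes the sign.\<close>
  define m1 where "m1 = (\<lambda>(k :: int) (j :: int). if even k then j - k div 2 else - j - (k + 1) div 2)"
  define k2 where "k2 = (\<lambda>(t :: int) (j :: int). if odd t then 2 * j else - 2 * j - 1)"
  define m2 where "m2 = (\<lambda>(t :: int) (j :: int). (t - k2 t j - 1) div 2)"
  define h1 where "h1 = (\<lambda>(k, j). (m1 k j + 2 * k, m1 k j))"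
  define h2 where "h2 = (\<lambda>(t, j). (m2 t j + 2 * k2 t j + 1, m2 t j))"
  have m2: "2 * m2 t j = t - k2 t j - 1" for t j
  proof -
    have "even (t - k2 t j - 1)" by (simp add: k2_def)
    then show ?thesis by (simp add: m2_def)
  qed
  have "jser 4 3 * jser 12 9 = gsum (\<lambda>(i, j). 1 * 1) (\<lambda>(i, j). jexp 4 3 i + jexp 12 9 j)"
    unfolding jser_def by (rule gsum_mult) (auto intro: adm_jexp)
  also have "\<dots> = gsum (\<lambda>(i, j). 1 * 1) (\<lambda>p. 2 * (case p of (k, j) \<Rightarrow> jexp 6 3 k + jexp 8 6 j)) +
      gsum (\<lambda>(i, j). 1 * 1) (\<lambda>p. 2 * (case p of (t, j) \<Rightarrow> jexp 2 1 t + jexp 24 18 j) + 1)"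
  proof (rule gsum_split[where ?h1.0 = h1 and ?h2.0 = h2])
    show "adm (\<lambda>(i, j). jexp 4 3 i + jexp 12 9 j)" by (intro adm_plus adm_jexp) auto
    show "inj h1" by (auto simp: inj_def h1_def m1_def split: if_splits)
    show "inj h2"
    proof (rule injI)
      fix p p' assume *: "h2 p = h2 p'"
      obtain t j t' j' where p: "p = (t, j)" "p' = (t', j')" by (cases p; cases p')
      \<comment> \<open>\<open>m\<close> and \<open>K\<close> determine
        \<open>t = 2 * m + K + 1\<close>; its parity selects the branch of \<open>k2\<close>, which
        is injective in \<open>j\<close>.\<close>
      have m: "m2 t j = m2 t' j'" and k: "k2 t j = k2 t' j'" using * by (auto simp: p h2_def)
      then have "t = t'" using m2[of t j] m2[of t' j'] by simp
      moreover have "j = j'" using k \<open>t = t'\<close> by (simp add: k2_def split: if_splits)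
      ultimately show "p = p'" by (simp add: p)
    qed
    show "h1 p \<noteq> h2 p'" for p p'
      by (cases p; cases p') (simp add: h1_def h2_def, presburger)
    show "(\<exists>p. i = h1 p) \<or> (\<exists>p. i = h2 p)" for i
    proof -
      obtain n m where i: "i = (n, m)" by (cases i)
      show ?thesis
      proof (cases "even (n - m)")
        case True
        then obtain k where k: "n = m + 2 * k" by (metis add.commute diff_add_cancel evenE)
        have "m1 k (if even k then m + k div 2 else - m - (k + 1) div 2) = m"
          by (simp add: m1_def)
        then have "i = h1 (k, if even k then m + k div 2 else - m - (k + 1) div 2)"
          by (simp add: i h1_def k)
        then show ?thesis by blast
      next
        case False
        then obtain k where k: "n = m + 2 * k + 1" by (metis add.assoc add.commute diff_add_cancel oddE)
        define t where "t = 2 * m + k + 1"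
        define j where "j = (if even k then k div 2 else - ((k + 1) div 2))"
        have "even k \<longleftrightarrow> odd t" by (simp add: t_def)
        moreover have "even k \<Longrightarrow> 2 * (k div 2) = k" "odd k \<Longrightarrow> 2 * ((k + 1) div 2) = k + 1" by presburger+
        ultimately have "k2 t j = k" by (auto simp: k2_def j_def)
        then have "i = h2 (t, j)"
          using m2[of t j] by (simp add: i h2_def k t_def)
        then show ?thesis by blast
      qed
    qed
    fix p :: "int \<times> int"
    show "(case h1 p of (i, j) \<Rightarrow> 1 * 1) = (case p of (i, j) \<Rightarrow> 1 * 1)"
      "(case h2 p of (i, j) \<Rightarrow> 1 * 1) = (case p of (i, j) \<Rightarrow> 1 * 1)"
      by (simp_all add: split_beta)
    obtain k j where p: "p = (k, j)" by (cases p)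
    show "(case h1 p of (i, j) \<Rightarrow> jexp 4 3 i + jexp 12 9 j) = 2 * (case p of (k, j) \<Rightarrow> jexp 6 3 k + jexp 8 6 j)"
    proof (cases "even k")
      case True
      then obtain l where "k = 2 * l" by (elim evenE)
      then show ?thesis
        unfolding p by (simp add: h1_def m1_def jexp_even algebra_simps)
    next
      case False
      then obtain l where "k = 2 * l + 1" by (elim oddE)
      then show ?thesis
        unfolding p by (simp add: h1_def m1_def jexp_even algebra_simps)
    qed
    show "(case h2 p of (i, j) \<Rightarrow> jexp 4 3 i + jexp 12 9 j) = 2 * (case p of (t, j) \<Rightarrow> jexp 2 1 t + jexp 24 18 j) + 1"
    proof -
      define M K where "M = m2 k j" and "K = k2 k j"
      have k: "k = 2 * M + K + 1" using m2[of k j] by (simp add: M_def K_def)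
      have K: "K = 2 * j \<or> K = - 2 * j - 1" by (auto simp: K_def k2_def)
      have "(case h2 p of (i, j) \<Rightarrow> jexp 4 3 i + jexp 12 9 j) = jexp 4 3 (M + 2 * K + 1) + jexp 12 9 M"
        by (simp add: p h2_def M_def K_def)
      moreover have "(case p of (t, j) \<Rightarrow> jexp 2 1 t + jexp 24 18 j) = jexp 2 1 (2 * M + K + 1) + jexp 24 18 j"
        by (simp only: p prod.case k)
      \<comment> \<open>\<open>K * (K + 1)\<close> is invariant under \<open>K -> - 1 - K\<close>,
        so both branches of \<open>k2\<close> give the same exponent.\<close>
      moreover have "K * (K + 1) = 2 * j * (2 * j + 1)"
        using K by (elim disjE; simp only:; simp add: algebra_simps)
      ultimately show ?thesis
        by (simp add: jexp_even algebra_simps)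
    qed
  qed
  also have "gsum (\<lambda>(i, j). 1 * 1) (\<lambda>p. 2 * (case p of (k, j) \<Rightarrow> jexp 6 3 k + jexp 8 6 j)) =
      dil (gsum (\<lambda>(i, j). 1 * 1) (\<lambda>(k, j). jexp 6 3 k + jexp 8 6 j))"
    by (rule gsum_dil)
  also have "gsum (\<lambda>(i, j). 1 * 1) (\<lambda>(k, j). jexp 6 3 k + jexp 8 6 j) = jser 6 3 * jser 8 6"
    unfolding jser_def by (rule gsum_mult[symmetric]) (auto intro: adm_jexp)
  also have "gsum (\<lambda>(i, j). 1 * 1) (\<lambda>p. 2 * (case p of (t, j) \<Rightarrow> jexp 2 1 t + jexp 24 18 j) + 1) =
      fps_X * gsum (\<lambda>(i, j). 1 * 1) (\<lambda>p. 2 * (case p of (t, j) \<Rightarrow> jexp 2 1 t + jexp 24 18 j))"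
    by (intro gsum_Suc adm_double adm_plus adm_jexp) auto
  also have "\<dots> = fps_X * dil (gsum (\<lambda>(i, j). 1 * 1) (\<lambda>(t, j). jexp 2 1 t + jexp 24 18 j))"
    by (simp only: gsum_dil)
  also have "gsum (\<lambda>(i, j). 1 * 1) (\<lambda>(t, j). jexp 2 1 t + jexp 24 18 j) = jser 2 1 * jser 24 18"
    unfolding jser_def by (rule gsum_mult[symmetric]) (auto intro: adm_jexp)
  finally show ?thesis .
qed

subsection \<open>Product formulas for the theta constants\<close>

lemma euler_f_eq_qp: "euler_f i = qp 1 i i"
  by (simp add: euler_f_def qp_def)

lemma euler_f_nth_0: "0 < i \<Longrightarrow> fps_nth (euler_f i) 0 = 1"
  by (simp add: euler_f_eq_qp qp_nth_0)

lemma dil_euler_f: "0 < i \<Longrightarrow> dil (euler_f i) = euler_f (2 * i)"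
  by (simp add: euler_f_eq_qp dil_qp)

lemma qp_split2:
  assumes "0 < a" "0 < m"
  shows "qp c a m = qp c a (2 * m) * qp c (a + m) (2 * m)"
proof -
  have "{..<2} = {0, 1 :: nat}" by auto
  then show ?thesis using qp_split[OF assms, of 2 c] by (simp add: mult.commute[of m])
qed

lemma qp_split3:
  assumes "0 < a" "0 < m"
  shows "qp c a m = qp c a (3 * m) * qp c (a + m) (3 * m) * qp c (a + 2 * m) (3 * m)"
proof -
  have "{..<3} = {0, 1, 2 :: nat}" by auto
  then show ?thesis using qp_split[OF assms, of 3 c] by (simp add: mult.commute[of m] mult.assoc)
qed

lemma euler_f_mult_qp_even:
  assumes "0 < i"
  shows "euler_f i * qp (- 1) i i = (euler_f (2 * i) :: 'a::comm_ring_1 fps)"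
  using qp_mult_neg[of i i "1 :: 'a"] assms by (simp add: euler_f_eq_qp)

text \<open>For \<open>i = 1\<close>: multiplication by \<open>(q;q^2) = f_1 / f_2\<close> turns
  \<open>(-q;q^2)\<close> into \<open>(q^2;q^4) = f_2 / f_4\<close>.\<close>

lemma euler_f_mult_qp_odd:
  assumes i: "0 < i"
  shows "qp (- 1) i (2 * i) * (euler_f i * euler_f (4 * i)) = (euler_f (2 * i) * euler_f (2 * i) :: 'a::comm_ring_1 fps)"
proof -
  have 1: "euler_f i = qp 1 i (2 * i) * (euler_f (2 * i) :: 'a fps)"
    using qp_split2[of i i "1 :: 'a"] i by (simp add: euler_f_eq_qp mult_2)
  have 2: "euler_f (2 * i) = qp 1 (2 * i) (4 * i) * (euler_f (4 * i) :: 'a fps)"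
    using qp_split2[of "2 * i" "2 * i" "1 :: 'a"] i by (simp add: euler_f_eq_qp)
  have 3: "qp 1 i (2 * i) * qp (- 1) i (2 * i) = (qp 1 (2 * i) (4 * i) :: 'a fps)"
    using qp_mult_neg[of i "2 * i" "1 :: 'a"] i by simp
  have "qp (- 1) i (2 * i) * (euler_f i * euler_f (4 * i)) =
      (qp 1 i (2 * i) * qp (- 1) i (2 * i)) * euler_f (4 * i) * (euler_f (2 * i) :: 'a fps)"
    unfolding 1 by (simp only: mult_ac)
  then show ?thesis unfolding 3 2[symmetric] .
qed

lemma jser_phi:
  assumes "0 < i"
  shows "jser (2 * i) i = qp (- 1) i (2 * i) * qp (- 1) i (2 * i) * (euler_f (2 * i) :: 'a::comm_ring_1 fps)"
  using jser_eq[of i "2 * i", where ?'a = 'a] assms by (simp add: euler_f_eq_qp mult_2)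

text \<open>The classes \<open>i\<close> and \<open>3 * i\<close> modulo \<open>4 * i\<close> from
  the triple product recombine into one class modulo \<open>2 * i\<close>.\<close>

lemma jser_psi:
  assumes "0 < i"
  shows "jser (4 * i) (3 * i) = qp (- 1) i (2 * i) * (euler_f (4 * i) :: 'a::comm_ring_1 fps)"
  using jser_eq[of "3 * i" "4 * i", where ?'a = 'a] qp_split2[of i "2 * i" "- 1 :: 'a"] assms
  by (simp add: euler_f_eq_qp mult_ac)

lemma jser_psi_mult_euler_f:
  assumes "0 < i"
  shows "jser (4 * i) (3 * i) * euler_f i = (euler_f (2 * i) * euler_f (2 * i) :: 'a::comm_ring_1 fps)"
  unfolding jser_psi[OF assms] euler_f_mult_qp_odd[OF assms, symmetric] by (simp only: mult_ac)

text \<open>The triple product supplies the classes \<open>1\<close> and \<open>5\<close> modulo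
  \<open>6\<close>; the multiplier adds the class \<open>3\<close> and completes the odd
  exponents.\<close>

lemma jser_6_5: "jser 6 5 * qp (- 1) 3 6 = qp (- 1) 1 2 * (euler_f 6 :: 'a::comm_ring_1 fps)"
  using jser_eq[of 5 6, where ?'a = 'a] qp_split3[of 1 2 "- 1 :: 'a"]
  by (simp add: euler_f_eq_qp mult_ac flip: numeral_3_eq_3)

text \<open>The classes \<open>2\<close> and \<open>4\<close> modulo \<open>6\<close> are completed
  by the multiples of \<open>6\<close>; \<open>euler_f_mult_qp_even\<close> then removes the
  products with sign \<open>-1\<close>.\<close>

lemma jser_6_2: "jser 6 2 * (euler_f 2 * euler_f 12) = (euler_f 4 * (euler_f 6 * euler_f 6) :: 'a::comm_ring_1 fps)"
proof -
  have 1: "jser 6 2 * qp (- 1) 6 6 = qp (- 1) 2 2 * (euler_f 6 :: 'a fps)"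
    using jser_eq[of 2 6, where ?'a = 'a] qp_split3[of 2 2 "- 1 :: 'a"]
    by (simp add: euler_f_eq_qp mult_ac)
  have 2: "euler_f 2 * qp (- 1) 2 2 = (euler_f 4 :: 'a fps)" "euler_f 6 * qp (- 1) 6 6 = (euler_f 12 :: 'a fps)"
    using euler_f_mult_qp_even[of 2, where ?'a = 'a] euler_f_mult_qp_even[of 6, where ?'a = 'a] by simp_all
  have "jser 6 2 * (euler_f 2 * euler_f 12) = (jser 6 2 * qp (- 1) 6 6) * (euler_f 6 * (euler_f 2 :: 'a fps))"
    unfolding 2(2)[symmetric] by (simp only: mult_ac)
  also have "\<dots> = (euler_f 2 * qp (- 1) 2 2) * (euler_f 6 * euler_f 6)"
    unfolding 1 by (simp only: mult_ac)
  finally show ?thesis unfolding 2(1) .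
qed

text \<open>Both sides reduce to the products \<open>M i\<close> and \<open>E i\<close>; the extra
  factor \<open>E 2\<close> serves to eliminate \<open>M 2\<close>. In the final computation this
  turns \<alpha> into \<beta> in the coefficient of \<open>U\<close>.\<close>

lemma phi3_psi2_eq:
  "jser 6 3 * jser 8 6 * jser 6 5 = jser 4 3 * jser 12 9 * (jser 6 2 :: 'a::comm_ring_1 fps)"
proof -
  define M where "M = (\<lambda>i. qp (- 1) i (2 * i) :: 'a fps)"
  define E where "E = (euler_f :: nat \<Rightarrow> 'a fps)"
  have phi: "jser 6 3 = M 3 * M 3 * E 6" and psi: "jser 8 6 = M 2 * E 8" "jser 4 3 = M 1 * E 4" "jser 12 9 = M 3 * E 12"
    using jser_phi[of 3, where ?'a = 'a] jser_psi[of 2, where ?'a = 'a]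
      jser_psi[of 1, where ?'a = 'a] jser_psi[of 3, where ?'a = 'a]
    by (simp_all add: M_def E_def)
  have al: "jser 6 5 * M 3 = M 1 * E 6" and be: "jser 6 2 * (E 2 * E 12) = E 4 * (E 6 * E 6)"
    and M2: "M 2 * (E 2 * E 8) = E 4 * E 4"
    using jser_6_5[where ?'a = 'a] jser_6_2[where ?'a = 'a] euler_f_mult_qp_odd[of 2, where ?'a = 'a]
    by (simp_all add: M_def E_def)
  have "E 2 * (jser 6 3 * jser 8 6 * jser 6 5) = (jser 6 5 * M 3) * (M 2 * (E 2 * E 8)) * (M 3 * E 6)"
    unfolding phi psi by (simp only: mult_ac)
  also have "\<dots> = M 1 * E 4 * M 3 * (E 4 * (E 6 * E 6))"
    unfolding al M2 by (simp only: mult_ac)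
  also have "\<dots> = E 2 * (jser 4 3 * jser 12 9 * jser 6 2)"
    unfolding be[symmetric] psi by (simp only: mult_ac)
  finally show ?thesis
    by (rule fps_unit_cancel[rotated]) (simp add: E_def euler_f_nth_0)
qed

text \<open>The companion for the coefficient of \<open>V\<close>, turning \<beta> into \<alpha>;
  here \<open>E 6\<close> serves to eliminate \<open>M 6\<close>.\<close>

lemma phi1_psi6_eq:
  "jser 2 1 * jser 24 18 * jser 6 2 = jser 4 3 * jser 12 9 * (jser 6 5 :: 'a::comm_ring_1 fps)"
proof -
  define M where "M = (\<lambda>i. qp (- 1) i (2 * i) :: 'a fps)"
  define E where "E = (euler_f :: nat \<Rightarrow> 'a fps)"
  have phi: "jser 2 1 = M 1 * M 1 * E 2" and psi: "jser 24 18 = M 6 * E 24" "jser 4 3 = M 1 * E 4" "jser 12 9 = M 3 * E 12"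
    using jser_phi[of 1, where ?'a = 'a] jser_psi[of 6, where ?'a = 'a]
      jser_psi[of 1, where ?'a = 'a] jser_psi[of 3, where ?'a = 'a]
    by (simp_all add: M_def E_def)
  have al: "jser 6 5 * M 3 = M 1 * E 6" and be: "jser 6 2 * (E 2 * E 12) = E 4 * (E 6 * E 6)"
    and M6: "M 6 * (E 6 * E 24) = E 12 * E 12"
    using jser_6_5[where ?'a = 'a] jser_6_2[where ?'a = 'a] euler_f_mult_qp_odd[of 6, where ?'a = 'a]
    by (simp_all add: M_def E_def)
  have "E 6 * (jser 2 1 * jser 24 18 * jser 6 2) = (M 6 * (E 6 * E 24)) * jser 6 2 * (M 1 * M 1 * E 2)"
    unfolding phi psi by (simp only: mult_ac)
  also have "\<dots> = (jser 6 2 * (E 2 * E 12)) * (E 12 * M 1 * M 1)"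
    unfolding M6 by (simp only: mult_ac)
  also have "\<dots> = (M 1 * E 6) * (E 6 * (M 1 * E 4 * E 12))"
    unfolding be by (simp only: mult_ac)
  also have "\<dots> = E 6 * (jser 4 3 * jser 12 9 * jser 6 5)"
    unfolding al[symmetric] psi by (simp only: mult_ac)
  finally show ?thesis
    by (rule fps_unit_cancel[rotated]) (simp add: E_def euler_f_nth_0)
qed

subsection \<open>The even part of the theta quotient\<close>

lemma unitize_theta_quotient:
  fixes X Xinv :: "'a::comm_ring_1"
  assumes X: "X * Xinv = 1"
  defines "T \<equiv> qp X 1 3 * qp Xinv 2 3 * (qp X 2 3 * qp Xinv 1 3)"
  assumes F: "F * (euler_f 1 * euler_f 3) = euler_f 2 * euler_f 6 * T"
  shows "unitize 2 F = F * F"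
proof -
  define E where "E = (euler_f :: nat \<Rightarrow> 'a fps)"
  define \<theta> where "\<theta> = qp X 1 6 * qp Xinv 5 6 * (qp X 5 6 * qp Xinv 1 6)"
  define U V where "U = gsum (\<lambda>n. upow (- X) (- Xinv) (2 * n)) (jexp 6 3)"
    and "V = gsum (\<lambda>n. upow (- X) (- Xinv) (2 * n + 1)) (\<lambda>n. 3 * (n * (n + 1)))"
  have E0: "fps_nth (E i) 0 = 1" if "0 < i" for i using that by (simp add: E_def euler_f_nth_0)
  have dilE: "dil (E 1) = E 2" "dil (E 3) = E 6"
    using dil_euler_f[of 1, where ?'a = 'a] dil_euler_f[of 3, where ?'a = 'a] by (simp_all add: E_def)
  \<comment> \<open>Taking \<open>- X\<close> for \<open>z\<close> makes the factor
    \<open>qp (- z)\<close> of the triple product equal to \<open>qp X\<close>.\<close>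
  have z: "(- X) * (- Xinv) = 1" using X by simp
  have jt: "qp X a m * qp Xinv (m - a) m * E m = gsum (upow (- X) (- Xinv)) (jexp m a)"
    if "0 < a" "a < m" for a m
    using jacobi_triple_product[OF z that] by (simp add: E_def euler_f_eq_qp)
  have "T * (E 3 * E 3) = (qp X 1 3 * qp Xinv 2 3 * E 3) * (qp X 2 3 * qp Xinv 1 3 * E 3)"
    unfolding T_def by (simp only: mult_ac)
  then have T: "T * (E 3 * E 3) = U * jser 6 2 + fps_X * (V * jser 6 5)"
    using jt[of 1 3] jt[of 2 3] theta_quad3_split[OF z] by (simp add: U_def V_def)
  have "\<theta> * (E 6 * E 6) = (qp X 1 6 * qp Xinv 5 6 * E 6) * (qp X 5 6 * qp Xinv 1 6 * E 6)"
    unfolding \<theta>_def by (simp only: mult_ac)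
  then have \<theta>: "\<theta> * (E 6 * E 6) = dil (U * jser 6 5) + fps_X * dil (V * jser 6 2)"
    using jt[of 1 6] jt[of 5 6] theta_quad6_split[OF z] by (simp add: U_def V_def)
  \<comment> \<open>Each class modulo \<open>3\<close> splits into an even and an odd class modulo
    \<open>6\<close>; the even ones form \<open>dil T\<close>, the odd ones
    \<open>\<theta>\<close>.\<close>
  have sp: "qp c 1 3 = qp c 1 6 * qp c 4 6" "qp c 2 3 = qp c 2 6 * qp c 5 6" for c :: 'a
    using qp_split2[of 1 3 c] qp_split2[of 2 3 c] by simp_all
  have "dil T = qp X 2 6 * qp Xinv 4 6 * (qp X 4 6 * qp Xinv 2 6)"
    using dil_qp[of 1 3 X] dil_qp[of 2 3 X] dil_qp[of 1 3 Xinv] dil_qp[of 2 3 Xinv]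
    by (simp add: T_def dil_mult)
  then have T\<theta>: "T = dil T * \<theta>"
    unfolding \<theta>_def by (simp only: T_def sp mult_ac)
  have psi: "jser 4 3 * E 1 = E 2 * E 2" "jser 12 9 * E 3 = E 6 * E 6"
    using jser_psi_mult_euler_f[of 1, where ?'a = 'a] jser_psi_mult_euler_f[of 3, where ?'a = 'a]
    by (simp_all add: E_def)
  have F: "F * (E 1 * E 3) = E 2 * E 6 * T" using F by (simp add: E_def)
  \<comment> \<open>The product formulas for \<psi> trade the denominator \<open>E 1 * E 3\<close>
    for \<open>E 2 * E 6\<close>, a series in \<open>q^2\<close>.\<close>
  have "(E 2 * E 6) * (F * (E 2 * E 6)) = F * ((jser 4 3 * E 1) * (jser 12 9 * E 3))"
    unfolding psi by (simp only: mult_ac)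
  also have "\<dots> = F * (E 1 * E 3) * (jser 4 3 * jser 12 9)" by (simp only: mult_ac)
  also have "\<dots> = (E 2 * E 6) * (T * (jser 4 3 * jser 12 9))" unfolding F by (simp only: mult_ac)
  finally have F2: "F * (E 2 * E 6) = T * (jser 4 3 * jser 12 9)"
    by (rule fps_unit_cancel[rotated]) (simp add: E0)
  \<comment> \<open>This multiplier passes through \<open>unitize 2\<close>. It equals
    \<open>E 2 * E 6 * (E 6 * E 6)\<close>, which clears the denominators of both \<open>F\<close>
    and \<open>\<theta>\<close>.\<close>
  have "dil (E 1 * E 3 * (E 3 * E 3)) * F = (F * (E 2 * E 6)) * (E 6 * E 6)"
    unfolding dil_mult dilE by (simp only: mult_ac)
  also have "\<dots> = dil T * (\<theta> * (E 6 * E 6)) * (jser 4 3 * jser 12 9)"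
    unfolding F2 by (subst T\<theta>) (simp only: mult_ac)
  also have "\<dots> = dil T * ((dil (U * jser 6 5) + fps_X * dil (V * jser 6 2)) *
      (dil (jser 6 3 * jser 8 6) + fps_X * dil (jser 2 1 * jser 24 18)))"
    unfolding \<theta> psi_psi3_split by (simp only: mult_ac)
  \<comment> \<open>The product of the two odd parts carries \<open>q^2\<close> and joins the even
    part; the mixed terms are \<open>q\<close> times a series in \<open>q^2\<close> and vanish under
    \<open>unitize 2\<close>.\<close>
  also have "\<dots> = dil T * (dil (U * jser 6 5 * (jser 6 3 * jser 8 6)) +
        fps_X ^ 2 * dil (V * jser 6 2 * (jser 2 1 * jser 24 18)) +
        fps_X * dil (V * jser 6 2 * (jser 6 3 * jser 8 6) + U * jser 6 5 * (jser 2 1 * jser 24 18)))"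
    by (simp add: dil_mult dil_add algebra_simps power2_eq_square)
  also have "fps_X ^ 2 * dil (V * jser 6 2 * (jser 2 1 * jser 24 18)) =
      dil (fps_X * (V * jser 6 2 * (jser 2 1 * jser 24 18)))"
    using dil_X_power[of 1, where ?'a = 'a] by (simp add: dil_mult)
  finally have "unitize 2 (dil (E 1 * E 3 * (E 3 * E 3)) * F) =
      T * (U * jser 6 5 * (jser 6 3 * jser 8 6) + fps_X * (V * jser 6 2 * (jser 2 1 * jser 24 18)))"
    by (simp only: unitize_dil_mult unitize_add unitize_dil unitize_X_dil add_0_right)
  also have "U * jser 6 5 * (jser 6 3 * jser 8 6) = U * (jser 6 3 * jser 8 6 * jser 6 5)" by (simp only: mult_ac)
  also have "V * jser 6 2 * (jser 2 1 * jser 24 18) = V * (jser 2 1 * jser 24 18 * jser 6 2)" by (simp only: mult_ac)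
  \<comment> \<open>The product formulas exchange the theta constants, which rebuilds the dissection
    of \<open>T * (E 3 * E 3)\<close>.\<close>
  also have "T * (U * (jser 6 3 * jser 8 6 * jser 6 5) + fps_X * (V * (jser 2 1 * jser 24 18 * jser 6 2))) =
      T * ((U * jser 6 2 + fps_X * (V * jser 6 5)) * (jser 4 3 * jser 12 9))"
    unfolding phi3_psi2_eq phi1_psi6_eq by (simp add: algebra_simps)
  finally have "E 1 * E 3 * (E 3 * E 3) * unitize 2 F = T * (T * (E 3 * E 3) * (jser 4 3 * jser 12 9))"
    unfolding unitize_dil_mult T .
  \<comment> \<open>The factor \<open>E 1 * E 3\<close> clears the two \<psi> series, so that both
    copies of \<open>T\<close> combine into the square of \<open>E 2 * E 6 * T\<close>.\<close>
  then have "(E 1 * E 3) * (E 1 * E 3 * (E 3 * E 3) * unitize 2 F) =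
      T * (T * (E 3 * E 3)) * ((jser 4 3 * E 1) * (jser 12 9 * E 3))"
    by (simp only: mult_ac)
  also have "\<dots> = (E 3 * E 3) * ((E 2 * E 6 * T) * (E 2 * E 6 * T))"
    unfolding psi by (simp only: mult_ac)
  also have "\<dots> = (E 1 * E 3) * (E 1 * E 3 * (E 3 * E 3) * (F * F))"
    unfolding F[symmetric] by (simp only: mult_ac)
  finally have "(E 1 * E 3 * (E 1 * E 3 * (E 3 * E 3))) * unitize 2 F =
      (E 1 * E 3 * (E 1 * E 3 * (E 3 * E 3))) * (F * F)"
    by (simp only: mult.assoc)
  then show ?thesis
    by (rule fps_unit_cancel[rotated]) (simp add: E0)
qed

theorem theorem1p2:
  fixes X Xinv :: "'a::comm_ring_1"
  assumes "X * Xinv = 1"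
  shows
    "let q = fps_X; x = fps_const X; x_inv = fps_const Xinv;
         F = fps_unit_quot (euler_f 2 * euler_f 6) (euler_f 1 * euler_f 3)
               * qpochs_inf [q * x, q ^ 2 * x_inv, q ^ 2 * x, q * x_inv] (q ^ 3)
     in unitize 2 F = F ^ 2"
proof -
  let ?G = "fps_unit_quot (euler_f 2 * euler_f 6) (euler_f 1 * euler_f 3) :: 'a fps"
  let ?T = "qp X 1 3 * qp Xinv 2 3 * (qp X 2 3 * qp Xinv 1 3)"
  have T: "qpochs_inf [fps_X * fps_const X, fps_X ^ 2 * fps_const Xinv, fps_X ^ 2 * fps_const X,
      fps_X * fps_const Xinv] (fps_X ^ 3) = ?T"
    by (simp add: qpochs_inf_def qp_def mult_ac)
  have "?G * (euler_f 1 * euler_f 3) = euler_f 2 * euler_f 6"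
    by (rule fps_unit_quot_mult) (simp add: euler_f_nth_0)
  then have "(?G * (euler_f 1 * euler_f 3)) * ?T = euler_f 2 * euler_f 6 * ?T"
    by (rule arg_cong)
  then have "(?G * ?T) * (euler_f 1 * euler_f 3) = euler_f 2 * euler_f 6 * ?T"
    by (simp only: mult_ac)
  from unitize_theta_quotient[OF assms this] show ?thesis
    unfolding Let_def T by (simp add: power2_eq_square)
qed

end
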